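(* Let $\mathcal{E}$ be a finite-dimensional real inner product space and let $\mathcal{K}^1,\mathcal{K}^2\subseteq\mathcal{E}$ be amenable pointed closed convex cones. Let $\mathcal{L}\subseteq\mathcal{E}$ be a subspace and $a\in\mathcal{E}$ with $\mathcal{K}^1\cap\mathcal{K}^2\cap(\mathcal{L}+a)\ne\emptyset$. Let $\hat{\mathcal{L}}\subseteq\mathcal{E}\times\mathcal{E}$ be a subspace and $\hat a\in\mathcal{E}\times\mathcal{E}$ such that $\hat{\mathcal{L}}+\hat a=\{(x,x): x\in\mathcal{L}+a\}$. The following hold. (i) Let $\mathcal{F}_\ell\subsetneq\cdots\subsetneq\mathcal{F}_1=\mathcal{K}^1\times\mathcal{K}^2$ be a chain of faces of $\mathcal{K}^1\times\mathcal{K}^2$ together with $z_i\in\mathcal{F}_i^*\cap\hat{\mathcal{L}}^\perp\cap\{\hat a\}^\perp$ such that $(\mathcal{F}_\ell,\hat{\mathcal{L}},\hat a)$ satisfies the PPS condition and $\mathcal{F}_{i+1}=\mathcal{F}_i\cap\{z_i\}^\perp$ for $i=1,\dots,\ell-1$. For $i=1,\dots,\ell-1$, let $\psi_i$ be a facial residual function for $\mathcal{F}_i,z_i$ with respect to $\mathcal{K}^1\times\mathcal{K}^2$. Then, after replacing each $\psi_i$ by a suitable positive rescaling of itself, there is a positive constant $\kappa$ (depending on $\mathcal{K}^1,\mathcal{K}^2,\mathcal{L},a$) such that whenever $x\in\operatorname{span}(\mathcal{K}^1\cap\mathcal{K}^2)$ and $\epsilon$ satisfy $$\operatorname{dist}(x,\mathcal{K}^1\cap\mathcal{K}^2)\le\epsilon,\qquad\operatorname{dist}(x,\mathcal{L}+a)\le\epsilon,$$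 we have $$\operatorname{dist}\bigl(x,(\mathcal{L}+a)\cap\mathcal{K}^1\cap\mathcal{K}^2\bigr)\le(\kappa\|x\|+\kappa)\bigl(\epsilon+\varphi(\epsilon,\|x\|)\bigr),$$ where $\varphi=\psi_{\ell-1}\diamondsuit\cdots\diamondsuit\psi_1$ if $\ell\ge2$, and $\varphi(\epsilon,\|x\|)=\epsilon$ if $\ell=1$. (ii) There exists at least one chain satisfying the requirements in (i) of length $\ell=d_{\mathrm{PPS}}(\hat{\mathcal{L}},\hat a)+1$, and $$d_{\mathrm{PPS}}(\hat{\mathcal{L}},\hat a)\le\min\{\ell_{\mathrm{poly}}(\mathcal{K}^1)+\ell_{\mathrm{poly}}(\mathcal{K}^2),\ \dim(\hat{\mathcal{L}}^\perp\cap\{\hat a\}^\perp),\ d_{\mathrm{S}}(\hat{\mathcal{L}},\hat a)\}.$$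
   Context: $\mathcal{E}\times\mathcal{E}$ carries the sum inner product. Norms are induced by the inner products and $\operatorname{dist}(x,C)=\inf\{\|x-y\|: y\in C\}$. A convex cone is a nonempty set closed under nonnegative linear combinations; it is pointed if $\mathcal{K}\cap-\mathcal{K}=\{0\}$. A face of $\mathcal{K}$ is a convex cone $\mathcal{F}\subseteq\mathcal{K}$ such that $x,y\in\mathcal{K}$, $x+y\in\mathcal{F}$ imply $x,y\in\mathcal{F}$. $C^*=\{x:\langle x,y\rangle\ge0\ \forall y\in C\}$, $C^\perp$ is the orthogonal complement, $\operatorname{ri}$ the relative interior. A closed convex cone $\mathcal{K}$ is amenable if for every face $\mathcal{F}$ of $\mathcal{K}$ there is $\kappa>0$ such that $\operatorname{dist}(x,\mathcal{F})\le\kappa\operatorname{dist}(x,\mathcal{K})$ for all $x\in\operatorname{span}\mathcal{F}$. PPS (partial polyhedral Slater) condition: for a closed convex cone $\mathcal{C}$ in a finite-dimensional inner product space $\mathcal{V}$, a subspace $\mathcal{M}\subseteq\mathcal{V}$ and $b\in\mathcal{V}$, $(\mathcal{C},\mathcal{M},b)$ satisfies the PPS condition if $\mathcal{V}$ can be written as an orthogonal product $\mathcal{V}=\mathcal{V}^1\times\mathcal{V}^2$ (a factor may be $\{0\}$) with $\mathcal{C}=\mathcal{C}^1\times\mathcal{C}^2$, where $\mathcal{C}^i\subseteq\mathcal{V}^i$ are closed convex cones, $\mathcal{C}^2$ is polyhedral, and there is $(x_1,x_2)\in\mathcal{M}+b$ with $x_1\in\operatorname{ri}\mathcal{C}^1$,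 $x_2\in\mathcal{C}^2$. (So it holds if $(\operatorname{ri}\mathcal{C})\cap(\mathcal{M}+b)\ne\emptyset$, or if $\mathcal{C}$ is polyhedral and $\mathcal{C}\cap(\mathcal{M}+b)\neq\emptyset$.) Facial residual function: let $\mathcal{F}$ be a face of a closed convex cone $\mathcal{K}$ and $z\in\mathcal{F}^*$. A function $\psi:\mathbb{R}_+\times\mathbb{R}_+\to\mathbb{R}_+$ is a facial residual function for $\mathcal{F},z$ with respect to $\mathcal{K}$ if (1) it is nonnegative, monotone nondecreasing in each argument, and $\psi(0,\alpha)=0$ for all $\alpha\ge0$; (2) whenever $x\in\operatorname{span}\mathcal{K}$ and $\epsilon\ge0$ satisfy $\operatorname{dist}(x,\mathcal{K})\le\epsilon$, $\langle x,z\rangle\le\epsilon$, $\operatorname{dist}(x,\operatorname{span}\mathcal{F})\le\epsilon$, we have $\operatorname{dist}(x,\mathcal{F}\cap\{z\}^\perp)\le\psi(\epsilon,\|x\|)$. A positive rescaling of $\psi$ is a function $(\epsilon,t)\mapsto M_3\,\psi(M_1\epsilon,M_2t)$ with constants $M_1,M_2,M_3>0$. The operation $\diamondsuit$ is $(f\diamondsuit g)(s,t)=f(s+g(s,t),t)$; iterated expressions are nested to the right: $\psi_{k}\diamondsuit\cdots\diamondsuit\psi_1=\psi_k\diamondsuit(\psi_{k-1}\diamondsuit\cdots\diamondsuit\psi_1)$. For the problem $(\mathcal{K}^1\times\mathcal{K}^2,\hat{\mathcal{L}},\hat a)$ consider sequences $\mathcal{F}_1=\mathcal{K}^1\times\mathcal{K}^2$,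 $z_i\in\mathcal{F}_i^*\cap\hat{\mathcal{L}}^\perp\cap\{\hat a\}^\perp$, $\mathcal{F}_{i+1}=\mathcal{F}_i\cap\{z_i\}^\perp$, $i=1,\dots,k$. $d_{\mathrm{PPS}}(\hat{\mathcal{L}},\hat a)$ is the minimum $k\ge0$ for which such a sequence exists with $(\mathcal{F}_{k+1},\hat{\mathcal{L}},\hat a)$ satisfying the PPS condition; $d_{\mathrm{S}}(\hat{\mathcal{L}},\hat a)$ (singularity degree) is the minimum $k\geq 0$ for which such a sequence exists with $\mathcal{F}_{k+1}$ equal to the minimal face of $\mathcal{K}^1\times\mathcal{K}^2$ containing $(\mathcal{K}^1\times\mathcal{K}^2)\cap(\hat{\mathcal{L}}+\hat a)$ (equivalently, $(\operatorname{ri}\mathcal{F}_{k+1})\cap(\hat{\mathcal{L}}+\hat a)\ne\emptyset$). Distance to polyhedrality: $\ell_{\mathrm{poly}}(\mathcal{C})$ is the length minus one of the longest chain of nonempty faces $\mathcal{G}_m\subsetneq\cdots\subsetneq\mathcal{G}_1$ of $\mathcal{C}$ (length $m$) such that $\mathcal{G}_m$ is polyhedral and $\mathcal{G}_j$ is not polyhedral for $j<m$. *)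

theory Defs
  imports "HOL-Analysis.Analysis"
begin

definition closed_convex_cone :: "'a::euclidean_space set \<Rightarrow> bool" where
  "closed_convex_cone K \<longleftrightarrow> closed K \<and> convex_cone K"

definition pointed :: "'a::euclidean_space set \<Rightarrow> bool" where
  "pointed K \<longleftrightarrow> K \<inter> uminus ` K = {0}"

definition cone_face :: "'a::euclidean_space set \<Rightarrow> 'a set \<Rightarrow> bool" where
  "cone_face F K \<longleftrightarrow>
     convex_cone F \<and> F \<subseteq> K \<and> (\<forall>x\<in>K. \<forall>y\<in>K. x + y \<in> F \<longrightarrow> x \<in> F \<and> y \<in> F)"

text \<open>On convex cones these are the nonempty faces in the sense of the library.\<close>

lemma cone_face_iff_face_of:
  assumes K: "convex_cone K"
  shows "cone_face F K \<longleftrightarrow> F face_of K \<and> F \<noteq> {}"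
proof
  assume F: "cone_face F K"
  have "a \<in> F \<and> b \<in> F"
    if ab: "a \<in> K" "b \<in> K" and x: "x \<in> F" "x \<in> open_segment a b" for a b x
  proof -
    obtain u where u: "0 < u" "u < 1" and xu: "x = (1 - u) *\<^sub>R a + u *\<^sub>R b"
      using x(2) by (auto simp: in_segment)
    have "(1 - u) *\<^sub>R a \<in> K" "u *\<^sub>R b \<in> K"
      using u ab convex_cone_scaleR[OF K] by simp_all
    then have *: "(1 - u) *\<^sub>R a \<in> F" "u *\<^sub>R b \<in> F"
      using F x(1) xu by (auto simp: cone_face_def)
    have "convex_cone F" using F by (simp add: cone_face_def)
    from convex_cone_scaleR[OF this, of "inverse (1 - u)", OF _ *(1)]
      convex_cone_scaleR[OF this, of "inverse u", OF _ *(2)]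
    show ?thesis using u by simp
  qed
  then show "F face_of K \<and> F \<noteq> {}"
    using F unfolding face_of_def cone_face_def convex_cone_def by blast
next
  assume F: "F face_of K \<and> F \<noteq> {}"
  then have FK: "F \<subseteq> K" and ccF: "convex_cone F"
    using face_of_conic[of K F] K by (auto simp: face_of_def convex_cone_def)
  have "x \<in> F \<and> y \<in> F" if xy: "x \<in> K" "y \<in> K" "x + y \<in> F" for x y
  proof -
    have m: "midpoint x y \<in> F"
      using convex_cone_scaleR[OF ccF _ xy(3), of "1/2"] by (simp add: midpoint_def)
    show ?thesis
    proof (cases "x = y")
      case True
      then show ?thesis using m by simp
    next
      case False
      then have "midpoint x y \<in> open_segment x y" by simp
      then show ?thesis using F m xy(1,2) unfolding face_of_def by blast
    qed
  qed
  then show "cone_face F K" using FK ccF by (auto simp: cone_face_def)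
qed

definition minimal_face :: "'a::euclidean_space set \<Rightarrow> 'a set \<Rightarrow> 'a set \<Rightarrow> bool" where
  "minimal_face F K S \<longleftrightarrow>
     cone_face F K \<and> S \<subseteq> F \<and> (\<forall>G. cone_face G K \<and> S \<subseteq> G \<longrightarrow> F \<subseteq> G)"

definition dual_cone :: "'a::euclidean_space set \<Rightarrow> 'a set" where
  "dual_cone C = {x. \<forall>y\<in>C. 0 \<le> x \<bullet> y}"

definition amenable :: "'a::euclidean_space set \<Rightarrow> bool" where
  "amenable K \<longleftrightarrow> closed_convex_cone K \<and>
     (\<forall>F. cone_face F K \<longrightarrow>
        (\<exists>\<kappa>>0. \<forall>x\<in>span F. infdist x F \<le> \<kappa> * infdist x K))"

text \<open>
  The orthogonal product decomposition of the ambient space is rendered internally: \<open>V1\<close> and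
  \<open>V2\<close> are mutually orthogonal subspaces spanning the space, a pair \<open>(x1, x2)\<close> is the vector
  \<open>x1 + x2\<close>, and \<open>C1 \<times> C2\<close> is the Minkowski sum \<open>C1 + C2\<close>.
\<close>

definition pps_condition ::
    "'a::euclidean_space set \<Rightarrow> 'a set \<Rightarrow> 'a \<Rightarrow> bool" where
  "pps_condition C M b \<longleftrightarrow>
     (\<exists>V1 V2 C1 C2.
        subspace V1 \<and> subspace V2 \<and> (\<forall>u\<in>V1. \<forall>v\<in>V2. orthogonal u v) \<and> V1 + V2 = UNIV \<and>
        closed_convex_cone C1 \<and> C1 \<subseteq> V1 \<and>
        closed_convex_cone C2 \<and> C2 \<subseteq> V2 \<and> polyhedron C2 \<and>
        C = C1 + C2 \<and>
        (\<exists>x1\<in>rel_interior C1. \<exists>x2\<in>C2. x1 + x2 \<in> (+) b ` M))"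

text \<open>
  Functions on the nonnegative quadrant are represented by total functions on the reals; only
  their values at nonnegative arguments matter.
\<close>

definition facial_residual_function ::
    "'a::euclidean_space set \<Rightarrow> 'a set \<Rightarrow> 'a \<Rightarrow> (real \<Rightarrow> real \<Rightarrow> real) \<Rightarrow> bool" where
  "facial_residual_function K F z \<psi> \<longleftrightarrow>
     (\<forall>s\<ge>0. \<forall>t\<ge>0. 0 \<le> \<psi> s t) \<and>
     (\<forall>t\<ge>0. mono_on {0..} (\<lambda>s. \<psi> s t)) \<and>
     (\<forall>s\<ge>0. mono_on {0..} (\<lambda>t. \<psi> s t)) \<and>
     (\<forall>t\<ge>0. \<psi> 0 t = 0) \<and>
     (\<forall>x\<in>span K. \<forall>\<epsilon>\<ge>0.
        infdist x K \<le> \<epsilon> \<and> x \<bullet> z \<le> \<epsilon> \<and> infdist x (span F) \<le> \<epsilon> \<longrightarrow>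
        infdist x (F \<inter> {z}\<^sup>\<bottom>) \<le> \<psi> \<epsilon> (norm x))"

definition positive_rescaling ::
    "(real \<Rightarrow> real \<Rightarrow> real) \<Rightarrow> (real \<Rightarrow> real \<Rightarrow> real) \<Rightarrow> bool" where
  "positive_rescaling \<psi> \<psi>' \<longleftrightarrow>
     (\<exists>M1>0. \<exists>M2>0. \<exists>M3>0. \<psi>' = (\<lambda>s t. M3 * \<psi> (M1 * s) (M2 * t)))"

definition diamond ::
    "(real \<Rightarrow> real \<Rightarrow> real) \<Rightarrow> (real \<Rightarrow> real \<Rightarrow> real) \<Rightarrow> real \<Rightarrow> real \<Rightarrow> real" where
  "diamond f g = (\<lambda>s t. f (s + g s t) t)"

text \<open>
  \<open>diamonds \<psi> k\<close> is the right-nested composition of \<open>\<psi> k, \<dots>, \<psi> 1\<close>; the empty composition is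
  \<open>(\<epsilon>, t) \<mapsto> \<epsilon>\<close>. Since that function is not neutral for \<open>diamond\<close>, the case \<open>k = 1\<close> is separate.
\<close>

fun diamonds :: "(nat \<Rightarrow> real \<Rightarrow> real \<Rightarrow> real) \<Rightarrow> nat \<Rightarrow> real \<Rightarrow> real \<Rightarrow> real" where
  "diamonds \<psi> 0 = (\<lambda>s t. s)"
| "diamonds \<psi> (Suc 0) = \<psi> 1"
| "diamonds \<psi> (Suc (Suc k)) = diamond (\<psi> (Suc (Suc k))) (diamonds \<psi> (Suc k))"

text \<open>\<open>k\<close> facial reduction steps, not necessarily strict, with \<open>F\<close> and \<open>z\<close> indexed from 1.\<close>

definition reduction_sequence ::
    "'a::euclidean_space set \<Rightarrow> 'a set \<Rightarrow> 'a \<Rightarrow> (nat \<Rightarrow> 'a set) \<Rightarrow> (nat \<Rightarrow> 'a) \<Rightarrow> nat \<Rightarrow> bool" where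
  "reduction_sequence K M b F z k \<longleftrightarrow>
     F 1 = K \<and>
     (\<forall>i\<in>{1..k}. z i \<in> dual_cone (F i) \<inter> M\<^sup>\<bottom> \<inter> {b}\<^sup>\<bottom> \<and> F (Suc i) = F i \<inter> {z i}\<^sup>\<bottom>)"

definition pps_chain ::
    "'a::euclidean_space set \<Rightarrow> 'a set \<Rightarrow> 'a \<Rightarrow> (nat \<Rightarrow> 'a set) \<Rightarrow> (nat \<Rightarrow> 'a) \<Rightarrow> nat \<Rightarrow> bool" where
  "pps_chain K M b F z l \<longleftrightarrow>
     1 \<le> l \<and> reduction_sequence K M b F z (l - 1) \<and>
     (\<forall>i\<in>{1..l}. cone_face (F i) K) \<and>
     (\<forall>i\<in>{1..<l}. F (Suc i) \<subset> F i) \<and>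
     pps_condition (F l) M b"

definition d_PPS :: "'a::euclidean_space set \<Rightarrow> 'a set \<Rightarrow> 'a \<Rightarrow> nat" where
  "d_PPS K M b =
     (LEAST k. \<exists>F z. reduction_sequence K M b F z k \<and> pps_condition (F (Suc k)) M b)"

definition singularity_degree :: "'a::euclidean_space set \<Rightarrow> 'a set \<Rightarrow> 'a \<Rightarrow> nat" where
  "singularity_degree K M b =
     (LEAST k. \<exists>F z. reduction_sequence K M b F z k \<and>
        minimal_face (F (Suc k)) K (K \<inter> (+) b ` M))"

definition polyhedrality_chain ::
    "'a::euclidean_space set \<Rightarrow> (nat \<Rightarrow> 'a set) \<Rightarrow> nat \<Rightarrow> bool" where
  "polyhedrality_chain C G m \<longleftrightarrow>
     1 \<le> m \<and> (\<forall>j\<in>{1..m}. cone_face (G j) C) \<and>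
     (\<forall>j\<in>{1..<m}. G (Suc j) \<subset> G j \<and> \<not> polyhedron (G j)) \<and>
     polyhedron (G m)"

definition distance_to_polyhedrality :: "'a::euclidean_space set \<Rightarrow> nat" where
  "distance_to_polyhedrality C = (GREATEST m. \<exists>G. polyhedrality_chain C G m) - 1"

end

theory Submission
  imports Defs
begin

text \<open>
  The bound in (i) comes from following \<open>(x, x)\<close> through the reduction: every functional \<open>z\<^sub>i\<close>
  vanishes on the affine space, so the residual function of step \<open>i\<close> turns closeness to \<open>F\<^sub>i\<close> into
  closeness to \<open>F\<^sub>i\<^sub>+\<^sub>1\<close>, and at the last face the PPS condition gives a Lipschitz error bound with
  a constant linear in the norm. That last constant depends on the chain, but a residual function
  of a proper reduction step is bounded below by a multiple of \<open>min \<epsilon> \<parallel>x\<parallel>\<close>, so rescaling the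
  outermost one absorbs it; this leaves one \<open>\<kappa>\<close> for all chains.

  For (ii), if the PPS condition fails, then a functional can be chosen that does not vanish on
  the nonpolyhedral part of the product. Hence each step strictly lowers the distance to
  polyhedrality of one of the two factors.
\<close>

text \<open>The difficulty in (i) is the order of quantifiers: \<open>\<kappa>\<close> is fixed
  before the chain, while the PPS bound at the last face has a constant \<open>k\<close> depending
  on that face, which multiplies both the residual term and \<open>\<epsilon>\<close> itself.
  Rescaling acts only on the residual term, so \<open>\<epsilon>\<close> must first be dominated by
  it; the lower bound by \<open>min \<epsilon> (norm x)\<close> does this, but only where
  \<open>\<epsilon> \<le> norm x\<close>. The region \<open>norm x < \<epsilon>\<close> is estimated
  by the distances of \<open>0\<close> to the affine space and to the feasible set. For
  \<open>l = 1\<close> there is nothing to rescale, but then the only face is the product cone and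
  its PPS constant belongs to the data. Thus \<open>\<kappa>\<close> collects just these two
  constants. Passing to \<open>(x, x)\<close> costs a factor \<open>2\<close>, which the rescalings
  take up when \<open>l > 1\<close>. In (ii) ordinary separation does not suffice, since its
  functional may vanish on the nonpolyhedral part; induction on the dimension of the polyhedral
  summand repairs this. Pointedness makes \<open>{0}\<close> a face, so that chains ending in a
  polyhedral face exist.\<close>

section \<open>Linear regularity of polyhedra\<close>

text \<open>The admissible \<open>d\<close> form the bipolar of the normals in \<open>J\<close>. The
  right side cannot vanish at such a nonzero \<open>d\<close>: all constraints would then hold at
  \<open>d\<close>, so \<open>e = d\<close> would be a permitted test vector and
  \<open>d \<bullet> d \<le> 0\<close>. Compactness of the unit vectors and homogeneity make this
  uniform.\<close>

lemma polar_halfspaces_gauge: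
  fixes J :: "('a::euclidean_space \<times> real) set"
  assumes J: "finite J"
  shows "\<exists>c>0. \<forall>d. (\<forall>e. (\<forall>(a,b)\<in>J. a \<bullet> e \<le> 0) \<longrightarrow> d \<bullet> e \<le> 0) \<longrightarrow>
           c * norm d \<le> (\<Sum>(a,b)\<in>J. max 0 (a \<bullet> d))"
proof -
  define Q where "Q = {d. \<forall>e. (\<forall>(a,b)\<in>J. a \<bullet> e \<le> 0) \<longrightarrow> d \<bullet> e \<le> 0}"
  define g where "g d = (\<Sum>(a,b)\<in>J. max 0 (a \<bullet> d))" for d
  have Q: "Q = (\<Inter>e\<in>{e. \<forall>(a,b)\<in>J. a \<bullet> e \<le> 0}. {d. e \<bullet> d \<le> 0})"
    by (auto simp: Q_def inner_commute)
  have comp: "compact (sphere 0 1 \<inter> Q)"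
    unfolding Q by (intro compact_Int_closed) (auto intro: closed_halfspace_le)
  have cont: "continuous_on S g" for S
    unfolding g_def case_prod_unfold by (intro continuous_intros)
  have pos: "0 < g d" if "d \<in> Q" "norm d = 1" for d
  proof (rule ccontr)
    assume "\<not> 0 < g d"
    moreover have "0 \<le> (\<lambda>(a,b). max 0 (a \<bullet> d)) p" for p by (cases p) auto
    ultimately have "\<forall>p\<in>J. (\<lambda>(a,b). max 0 (a \<bullet> d)) p = 0"
      using sum_nonneg_eq_0_iff[OF J, of "\<lambda>(a,b). max 0 (a \<bullet> d)"] sum_nonneg[of J "\<lambda>(a,b). max 0 (a \<bullet> d)"]
      unfolding g_def by force
    then have "\<forall>(a,b)\<in>J. a \<bullet> d \<le> 0" by (auto simp: max_def split: if_splits)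
    then have "d \<bullet> d \<le> 0" using that(1) unfolding Q_def by blast
    then show False using that(2) by (simp add: dot_square_norm)
  qed
  obtain c where c: "c > 0" "\<And>d. d \<in> Q \<Longrightarrow> norm d = 1 \<Longrightarrow> c \<le> g d"
  proof (cases "sphere 0 1 \<inter> Q = {}")
    case True
    then have "d \<notin> Q" if "norm d = 1" for d using that by (auto simp: disjoint_iff)
    then show ?thesis using that[of 1] by auto
  next
    case False
    from continuous_attains_inf[OF comp this cont]
    obtain d0 where "d0 \<in> sphere 0 1 \<inter> Q" "\<And>d. d \<in> sphere 0 1 \<inter> Q \<Longrightarrow> g d0 \<le> g d" by blast
    then show ?thesis using that[of "g d0"] pos by auto
  qed
  have "c * norm d \<le> g d" if d: "d \<in> Q" for d
  proof (cases "d = 0")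
    case True
    then show ?thesis by (simp add: g_def case_prod_unfold)
  next
    case False
    have "(inverse (norm d)) *\<^sub>R d \<in> Q"
      using d by (auto simp: Q_def mult_nonneg_nonpos)
    then have "c \<le> g (inverse (norm d) *\<^sub>R d)" using c False by auto
    also have "g (inverse (norm d) *\<^sub>R d) = inverse (norm d) * g d"
    proof -
      have "max 0 (a \<bullet> (inverse (norm d) *\<^sub>R d)) = inverse (norm d) * max 0 (a \<bullet> d)" for a
        by (simp add: max_mult_distrib_left)
      then show ?thesis unfolding g_def by (simp add: sum_distrib_left case_prod_unfold)
    qed
    finally show ?thesis using False by (simp add: field_simps)
  qed
  then show ?thesis using c(1) unfolding Q_def g_def by blast
qed

text \<open>
  Hoffman's bound. The displacement from the projection lies in the polar of the cone cut out by
  the active constraints, and there are only finitely many sets of active constraints.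
\<close>

lemma hoffman_halfspaces:
  fixes I :: "('a::euclidean_space \<times> real) set"
  assumes I: "finite I" and P: "P = {x. \<forall>(a,b)\<in>I. a \<bullet> x \<le> b}" and ne: "P \<noteq> {}"
  shows "\<exists>\<kappa>>0. \<forall>x d. 0 \<le> d \<and> (\<forall>(a,b)\<in>I. a \<bullet> x - b \<le> d) \<longrightarrow> infdist x P \<le> \<kappa> * d"
proof -
  have "\<forall>J\<in>Pow I. \<exists>c>0. \<forall>d. (\<forall>e. (\<forall>(a,b)\<in>J. a \<bullet> e \<le> 0) \<longrightarrow> d \<bullet> e \<le> 0) \<longrightarrow>
           c * norm d \<le> (\<Sum>(a,b)\<in>J. max 0 (a \<bullet> d))"
    by (intro ballI polar_halfspaces_gauge) (use I finite_subset in blast)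
  then obtain f where f: "\<And>J. J \<in> Pow I \<Longrightarrow> f J > 0"
     "\<And>J d. J \<in> Pow I \<Longrightarrow> (\<forall>e. (\<forall>(a,b)\<in>J. a \<bullet> e \<le> 0) \<longrightarrow> d \<bullet> e \<le> 0) \<Longrightarrow>
           f J * norm d \<le> (\<Sum>(a,b)\<in>J. max 0 (a \<bullet> d))"
    by metis
  define c where "c = Min (f ` Pow I)"
  have fin: "finite (f ` Pow I)" "f ` Pow I \<noteq> {}" using I by auto
  have c: "c > 0" unfolding c_def using fin f(1) by (subst Min_gr_iff) auto
  have cf: "c \<le> f J" if "J \<subseteq> I" for J unfolding c_def using fin that by auto
  have Peq: "P = (\<Inter>(a,b)\<in>I. {x. a \<bullet> x \<le> b})" unfolding P by auto
  have cl: "closed P" unfolding Peq case_prod_unfold by (intro closed_INT) (auto intro: closed_halfspace_le)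
  have cv: "convex P" unfolding Peq case_prod_unfold by (intro convex_INT) (auto intro: convex_halfspace_le)
  have "infdist x P \<le> ((card I + 1) / c) * d"
    if d: "0 \<le> d" "\<forall>(a,b)\<in>I. a \<bullet> x - b \<le> d" for x d
  proof -
    define y where "y = closest_point P x"
    have y: "y \<in> P" unfolding y_def using cl ne by (rule closest_point_in_set)
    define J where "J = {(a,b)\<in>I. a \<bullet> y = b}"
    have JI: "J \<subseteq> I" unfolding J_def by auto
    have "(x - y) \<bullet> e \<le> 0" if e: "\<forall>(a,b)\<in>J. a \<bullet> e \<le> 0" for e
    proof -
      \<comment> \<open>At \<open>y\<close> the inactive constraints are strict and \<open>e\<close>
        respects the active ones, so a short step along \<open>e\<close> stays in \<open>P\<close>
        and the projection inequality applies.\<close>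
      have "\<forall>\<^sub>F t in at_right (0::real). \<forall>p\<in>I. fst p \<bullet> (y + t *\<^sub>R e) \<le> snd p"
      proof (rule eventually_ball_finite[OF I], rule ballI)
        fix p assume p: "p \<in> I"
        show "\<forall>\<^sub>F t in at_right (0::real). fst p \<bullet> (y + t *\<^sub>R e) \<le> snd p"
        proof (cases "fst p \<bullet> y = snd p")
          case True
          then have "fst p \<bullet> e \<le> 0" using e p unfolding J_def by (cases p) auto
          then show ?thesis using True
            by (intro eventually_at_right_less[THEN eventually_mono])
               (simp add: inner_add_right mult_nonneg_nonpos)
        next
          case False
          then have lt: "fst p \<bullet> y < snd p" using y p unfolding P by (cases p) force
          have "((\<lambda>t. fst p \<bullet> (y + t *\<^sub>R e)) \<longlongrightarrow> fst p \<bullet> (y + 0 *\<^sub>R e)) (at_right 0)"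
            by (intro tendsto_intros)
          from order_tendstoD(2)[OF this, of "snd p"] lt show ?thesis
            by (auto elim!: eventually_mono)
        qed
      qed
      then have "\<forall>\<^sub>F t in at_right (0::real). 0 < t \<and> (\<forall>p\<in>I. fst p \<bullet> (y + t *\<^sub>R e) \<le> snd p)"
        by (intro eventually_conj eventually_at_right_less)
      then obtain t :: real where t: "t > 0" "\<forall>p\<in>I. fst p \<bullet> (y + t *\<^sub>R e) \<le> snd p"
        using eventually_happens' trivial_limit_at_right_real by blast
      then have "y + t *\<^sub>R e \<in> P" unfolding P by auto
      from closest_point_dot[OF cv cl this, of x] have "t * ((x - y) \<bullet> e) \<le> 0"
        unfolding y_def by simp
      then show ?thesis using t(1) by (simp add: mult_le_0_iff)
    qed
    then have "f J * norm (x - y) \<le> (\<Sum>(a,b)\<in>J. max 0 (a \<bullet> (x - y)))"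
      using f(2)[of J "x - y"] JI by blast
    \<comment> \<open>Active constraints have \<open>a \<bullet> y = b\<close>, so
      \<open>a \<bullet> (x - y)\<close> is the violation at \<open>x\<close>.\<close>
    also have "\<dots> \<le> (\<Sum>p\<in>J. d)"
      using d JI by (intro sum_mono) (fastforce simp: J_def inner_diff_right)
    \<comment> \<open>Using \<open>card I + 1\<close> keeps the constant positive for empty
      \<open>I\<close>.\<close>
    also have "\<dots> \<le> real (card I + 1) * d"
      using d(1) card_mono[OF I JI] by (simp add: mult_right_mono)
    finally have "f J * norm (x - y) \<le> real (card I + 1) * d" .
    moreover have "c * norm (x - y) \<le> f J * norm (x - y)" using cf[OF JI] by (intro mult_right_mono) auto
    ultimately have "c * dist x y \<le> real (card I + 1) * d" by (simp add: dist_norm)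
    then show ?thesis using infdist_le[OF y, of x] c by (simp add: field_simps) (smt (verit) mult_left_mono)
  qed
  then show ?thesis using c by (intro exI[of _ "(card I + 1) / c"]) auto
qed

lemma polyhedron_eq_halfspaces:
  assumes "polyhedron S"
  obtains I where "finite I" "S = {x. \<forall>(a,b)\<in>I. a \<bullet> x \<le> b}"
proof -
  obtain F where F: "finite F" "S = \<Inter>F" and h: "\<forall>h\<in>F. \<exists>p. h = {x. fst p \<bullet> x \<le> snd p}"
    using assms unfolding polyhedron_def by (metis fst_conv snd_conv)
  obtain p where p: "\<And>h. h \<in> F \<Longrightarrow> h = {x. fst (p h) \<bullet> x \<le> snd (p h)}" using h by metis
  have "x \<in> h \<longleftrightarrow> fst (p h) \<bullet> x \<le> snd (p h)" if "h \<in> F" for h x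
    using p[OF that] by blast
  then have "x \<in> S \<longleftrightarrow> (\<forall>(a,b)\<in>p ` F. a \<bullet> x \<le> b)" for x
    unfolding F(2) case_prod_unfold by auto
  then show ?thesis using that[of "p ` F"] F(1) by blast
qed

text \<open>By Cauchy-Schwarz, \<open>norm a\<close> is a Lipschitz constant of the functional.
  Applied to the constraints of a polyhedron and, with \<open>b = 0\<close>, to functionals
  vanishing on the affine space.\<close>

lemma inner_le_infdist_halfspace:
  assumes "S \<noteq> {}" "\<And>y. y \<in> S \<Longrightarrow> a \<bullet> y \<le> b"
  shows "a \<bullet> x - b \<le> norm a * infdist x S"
proof (cases "a = 0")
  case True
  then show ?thesis using assms by force
next
  case False
  have "(a \<bullet> x - b) / norm a \<le> dist x y" if "y \<in> S" for y
  proof -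
    have "a \<bullet> x - b \<le> a \<bullet> (x - y)" using assms(2)[OF that] by (simp add: inner_diff_right)
    also have "\<dots> \<le> norm a * dist x y" unfolding dist_norm by (rule norm_cauchy_schwarz)
    finally show ?thesis using False by (simp add: field_simps)
  qed
  then have "(a \<bullet> x - b) / norm a \<le> infdist x S"
    unfolding infdist_notempty[OF assms(1)] by (intro cINF_greatest assms)
  then show ?thesis using False by (simp add: field_simps)
qed

text \<open>Hoffman's bound for the union of the two constraint systems: each constraint comes from
  one of the polyhedra, whose distance controls its violation.\<close>

lemma polyhedra_linear_regularity:
  fixes P Q :: "'a::euclidean_space set"
  assumes "polyhedron P" "polyhedron Q" "P \<inter> Q \<noteq> {}"
  shows "\<exists>\<kappa>>0. \<forall>x d. infdist x P \<le> d \<and> infdist x Q \<le> d \<longrightarrow> infdist x (P \<inter> Q) \<le> \<kappa> * d"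
proof -
  obtain I where I: "finite I" "P = {x. \<forall>(a,b)\<in>I. a \<bullet> x \<le> b}"
    using polyhedron_eq_halfspaces assms(1) by blast
  obtain J where J: "finite J" "Q = {x. \<forall>(a,b)\<in>J. a \<bullet> x \<le> b}"
    using polyhedron_eq_halfspaces assms(2) by blast
  have IJ: "finite (I \<union> J)" "P \<inter> Q = {x. \<forall>(a,b)\<in>I \<union> J. a \<bullet> x \<le> b}" using I J by auto
  from hoffman_halfspaces[OF this assms(3)] obtain k where k: "k > 0"
    "\<And>x d. 0 \<le> d \<Longrightarrow> (\<forall>(a,b)\<in>I \<union> J. a \<bullet> x - b \<le> d) \<Longrightarrow> infdist x (P \<inter> Q) \<le> k * d"
    by blast
  \<comment> \<open>A sum dominates every single norm without a maximum over a possibly empty set;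
    \<open>+ 1\<close> makes it positive.\<close>
  define N where "N = (\<Sum>p\<in>I \<union> J. norm (fst p)) + 1"
  have N: "norm a \<le> N" if "(a,b) \<in> I \<union> J" for a b
    using member_le_sum[OF that, of "\<lambda>p. norm (fst p)"] IJ(1) by (simp add: N_def)
  have N0: "N > 0" unfolding N_def by (smt (verit) sum_nonneg norm_ge_zero)
  have "infdist x (P \<inter> Q) \<le> (k * N) * d" if d: "infdist x P \<le> d" "infdist x Q \<le> d" for x d
  proof -
    have d0: "0 \<le> d" using d(1) infdist_nonneg[of x P] by linarith
    have "a \<bullet> x - b \<le> N * d" if ab: "(a,b) \<in> I \<union> J" for a b
    proof -
      obtain R where R: "R \<noteq> {}" "\<And>y. y \<in> R \<Longrightarrow> a \<bullet> y \<le> b" "infdist x R \<le> d"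
      proof (cases "(a,b) \<in> I")
        case True
        then show ?thesis using assms(3) d I(2) by (intro that[of P]) auto
      next
        case False
        then show ?thesis using ab assms(3) d J(2) by (intro that[of Q]) auto
      qed
      have "a \<bullet> x - b \<le> norm a * infdist x R" using inner_le_infdist_halfspace R by blast
      also have "\<dots> \<le> N * d" using N[OF ab] R(3) N0 by (intro mult_mono) (auto simp: infdist_nonneg)
      finally show ?thesis .
    qed
    then have "infdist x (P \<inter> Q) \<le> k * (N * d)"
      using k(2)[of "N * d" x] N0 d0 by auto
    then show ?thesis by (simp add: mult.assoc)
  qed
  then show ?thesis using k(1) N0 by (intro exI[of _ "k * N"]) auto
qed

lemma polyhedron_linear_vimage:
  fixes f :: "'a::euclidean_space \<Rightarrow> 'b::euclidean_space"
  assumes "linear f" "polyhedron S"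
  shows "polyhedron (f -` S)"
proof -
  obtain I where I: "finite I" "S = {x. \<forall>(a,b)\<in>I. a \<bullet> x \<le> b}"
    using polyhedron_eq_halfspaces assms(2) by blast
  have "f -` S = \<Inter> ((\<lambda>p. {x. adjoint f (fst p) \<bullet> x \<le> snd p}) ` I)"
    unfolding I(2) using adjoint_works[OF assms(1)] by (auto simp: inner_commute case_prod_unfold)
  also have "polyhedron \<dots>" using I(1) by (intro polyhedron_Inter) (auto simp: polyhedron_halfspace_le)
  finally show ?thesis .
qed

lemma polyhedron_Times:
  fixes S :: "'a::euclidean_space set" and T :: "'b::euclidean_space set"
  assumes "polyhedron S" "polyhedron T"
  shows "polyhedron (S \<times> T)"
proof -
  have "S \<times> T = fst -` S \<inter> snd -` T" by auto
  then show ?thesis using assms by (simp add: polyhedron_linear_vimage linear_fst linear_snd)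
qed

lemma polyhedron_subspace: "subspace S \<Longrightarrow> polyhedron (S :: 'a::euclidean_space set)"
  by (simp add: affine_imp_polyhedron subspace_imp_affine)

section \<open>Error bound under the PPS condition\<close>

lemma closed_convex_coneD:
  assumes "closed_convex_cone C"
  shows "closed C" "convex_cone C" "convex C" "0 \<in> C" "C \<noteq> {}"
    "\<And>x y. x \<in> C \<Longrightarrow> y \<in> C \<Longrightarrow> x + y \<in> C" "\<And>x c. x \<in> C \<Longrightarrow> 0 \<le> c \<Longrightarrow> c *\<^sub>R x \<in> C"
proof -
  show c: "closed C" "convex_cone C" using assms by (simp_all add: closed_convex_cone_def)
  then show "convex C" "C \<noteq> {}" by (simp_all add: convex_cone_def)
  show "0 \<in> C" using c(2) by (rule convex_cone_contains_0)
  show "x + y \<in> C" if "x \<in> C" "y \<in> C" for x y using c(2) that by (rule convex_cone_add)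
  show "c *\<^sub>R x \<in> C" if "x \<in> C" "0 \<le> c" for x c using c(2) that(2,1) by (rule convex_cone_scaleR)
qed

lemma closed_convex_cone_singleton: "closed_convex_cone {0}"
  by (simp add: closed_convex_cone_def)

lemma closed_convex_cone_Times:
  "closed_convex_cone A \<Longrightarrow> closed_convex_cone B \<Longrightarrow> closed_convex_cone (A \<times> B)"
  by (simp add: closed_convex_cone_def closed_Times convex_cone_Times)

lemma closed_convex_cone_Int:
  "closed_convex_cone A \<Longrightarrow> closed_convex_cone B \<Longrightarrow> closed_convex_cone (A \<inter> B)"
  unfolding closed_convex_cone_def
  using convex_cone_Inter[of "{A, B}"] by (auto simp: closed_Int)

text \<open>Orthogonality makes the decomposition unique, hence the \<open>V2\<close>-component
  linear. The PPS cone can then be written by preimages, which carry closedness and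
  polyhedrality.\<close>

lemma orthogonal_decomposition_linear:
  fixes V1 V2 :: "'a::euclidean_space set"
  assumes V: "subspace V1" "subspace V2" and orth: "\<forall>u\<in>V1. \<forall>v\<in>V2. orthogonal u v"
    and full: "V1 + V2 = UNIV"
  obtains p where "linear p" "\<And>x. p x \<in> V2" "\<And>x. x - p x \<in> V1"
    "\<And>u v. u \<in> V1 \<Longrightarrow> v \<in> V2 \<Longrightarrow> p (u + v) = v"
proof -
  have uniq: "v = v'" if "u \<in> V1" "v \<in> V2" "u' \<in> V1" "v' \<in> V2" "u + v = u' + v'" for u v u' v'
  proof -
    have "u - u' = v' - v" using that(5) by (simp add: algebra_simps)
    moreover have "orthogonal (u - u') (v' - v)"
      using orth that V by (blast intro: subspace_diff)
    ultimately have "orthogonal (v' - v) (v' - v)" by simp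
    then show ?thesis by (simp add: orthogonal_self)
  qed
  have "\<exists>v. v \<in> V2 \<and> x - v \<in> V1" for x
  proof -
    have "x \<in> V1 + V2" using full by simp
    then obtain u v where "u \<in> V1" "v \<in> V2" "x = u + v" by (auto elim: set_plus_elim)
    then show ?thesis by (intro exI[of _ v]) auto
  qed
  then obtain p where p: "\<And>x. p x \<in> V2" "\<And>x. x - p x \<in> V1" by metis
  have p': "p (u + v) = v" if "u \<in> V1" "v \<in> V2" for u v
    using uniq[of "u + v - p (u + v)" "p (u + v)" u v] p that by auto
  have "linear p"
  proof (rule linearI)
    fix x y :: 'a and c :: real
    have "p ((x - p x) + (y - p y) + (p x + p y)) = p x + p y"
      by (intro p' subspace_add V p)
    then show "p (x + y) = p x + p y" by (simp add: algebra_simps)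
    have "p (c *\<^sub>R (x - p x) + c *\<^sub>R p x) = c *\<^sub>R p x"
      by (intro p' subspace_scale V p)
    then show "p (c *\<^sub>R x) = c *\<^sub>R p x" by (simp add: algebra_simps)
  qed
  then show ?thesis using that p p' by blast
qed

text \<open>
  Only \<open>span C1 + C2\<close> is polyhedral, so Hoffman's bound first yields a nearby point there; moving
  it towards the Slater point then repairs its \<open>C1\<close>-component.
\<close>

lemma pps_error_bound:
  fixes C M :: "'a::euclidean_space set"
  assumes pps: "pps_condition C M b" and M: "subspace M"
  shows "\<exists>\<kappa>>0. \<forall>x \<epsilon>. infdist x C \<le> \<epsilon> \<and> infdist x ((+) b ` M) \<le> \<epsilon> \<longrightarrow>
            infdist x (C \<inter> (+) b ` M) \<le> \<kappa> * (norm x + 1) * \<epsilon>"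
proof -
  define A where "A = (+) b ` M"
  obtain V1 V2 C1 C2 x1 x2 where V: "subspace V1" "subspace V2"
      and orth: "\<forall>u\<in>V1. \<forall>v\<in>V2. orthogonal u v" and full: "V1 + V2 = UNIV"
      and C1: "closed_convex_cone C1" "C1 \<subseteq> V1"
      and C2: "closed_convex_cone C2" "C2 \<subseteq> V2" "polyhedron C2"
      and C: "C = C1 + C2" and x1: "x1 \<in> rel_interior C1" and x2: "x2 \<in> C2" and xA: "x1 + x2 \<in> A"
    using pps unfolding pps_condition_def A_def by (elim exE conjE bexE)
  obtain p where p: "linear p" "\<And>x. p x \<in> V2" "\<And>x. x - p x \<in> V1"
    "\<And>u v. u \<in> V1 \<Longrightarrow> v \<in> V2 \<Longrightarrow> p (u + v) = v"
    using orthogonal_decomposition_linear[OF V orth full] by blast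
  define q where "q x = x - p x" for x
  have q: "linear q" unfolding q_def using p(1) by (intro linear_compose_sub linear_ident)
  note C1' = closed_convex_coneD[OF C1(1)] and C2' = closed_convex_coneD[OF C2(1)]
  have affA: "affine A" unfolding A_def
    by (metis M affine_translation subspace_imp_affine)
  have Ceq: "C = p -` C2 \<inter> q -` C1"
  proof (intro equalityI subsetI)
    fix x assume "x \<in> C"
    then obtain u v where uv: "u \<in> C1" "v \<in> C2" "x = u + v" unfolding C by (auto elim: set_plus_elim)
    then have "p x = v" using p(4) C1(2) C2(2) by blast
    then show "x \<in> p -` C2 \<inter> q -` C1" using uv by (simp add: q_def)
  next
    fix x assume "x \<in> p -` C2 \<inter> q -` C1"
    then have "q x + p x \<in> C" unfolding C by (intro set_plus_intro) auto
    then show "x \<in> C" by (simp add: q_def)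
  qed
  have clC: "closed C" unfolding Ceq using C1' C2' p(1) q
    by (intro closed_Int closed_vimage) (auto simp: linear_continuous_on linear_conv_bounded_linear)
  define Y where "Y = p -` C2 \<inter> q -` span C1"
  have polyY: "polyhedron Y" unfolding Y_def
    using polyhedron_linear_vimage[OF p(1) C2(3)]
      polyhedron_linear_vimage[OF q polyhedron_subspace[OF subspace_span]] by simp
  have CY: "C \<subseteq> Y" unfolding Ceq Y_def using span_superset by blast
  have x1C: "x1 \<in> C1" using x1 rel_interior_subset by blast
  have xC: "x1 + x2 \<in> C" unfolding C using x1C x2 by (rule set_plus_intro)
  have neC: "C \<noteq> {}" using xC by blast
  have pqx: "p (x1 + x2) = x2" using p(4) x1C x2 C1(2) C2(2) by blast
  then have pqx': "q (x1 + x2) = x1" by (simp add: q_def)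
  have polyA: "polyhedron A" using affA by (rule affine_imp_polyhedron)
  have neYA: "Y \<inter> A \<noteq> {}" using CY xC xA by blast
  from polyhedra_linear_regularity[OF polyY polyA neYA] obtain k where k: "k > 0"
    "\<And>x d. infdist x Y \<le> d \<Longrightarrow> infdist x A \<le> d \<Longrightarrow> infdist x (Y \<inter> A) \<le> k * d" by blast
  have clYA: "closed (Y \<inter> A)" using polyY polyA by (simp add: closed_Int polyhedron_imp_closed)
  have hull: "affine hull C1 = span C1" using C1'(4) by (simp add: affine_hull_span_0 hull_inc)
  obtain r where r: "r > 0" "cball x1 r \<inter> span C1 \<subseteq> C1"
    using x1 unfolding mem_rel_interior_cball hull by blast
  \<comment> \<open>The first summand pays for the Hoffman error \<open>k * \<epsilon>\<close>, once
    from \<open>x\<close> to \<open>y\<close> and once inside the estimate from \<open>y\<close> to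
    \<open>w\<close>. The second is the step length \<open>(1 + k) * \<epsilon> / r\<close> towards
    the Slater point times a bound for the distance to it.\<close>
  define K where "K = 2 * k + (1 + k) / r * (1 + norm (x1 + x2))"
  have K: "K > 0" unfolding K_def using k(1) r(1)
    by (intro add_pos_nonneg mult_nonneg_nonneg divide_nonneg_pos) auto
  have "infdist x (C \<inter> A) \<le> K * (norm x + 1) * \<epsilon>" if x: "infdist x C \<le> \<epsilon>" "infdist x A \<le> \<epsilon>" for x \<epsilon>
  proof -
    have eps: "0 \<le> \<epsilon>" using x(1) infdist_nonneg[of x C] by linarith
    have "infdist x Y \<le> \<epsilon>" using infdist_mono[OF CY neC, of x] x(1) by linarith
    then have "infdist x (Y \<inter> A) \<le> k * \<epsilon>" using k(2) x(2) by blast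
    then obtain y where y: "y \<in> Y" "y \<in> A" "dist x y \<le> k * \<epsilon>"
      using infdist_attains_inf[OF clYA neYA, of x] by (metis IntE)
    define \<delta> where "\<delta> = (1 + k) * \<epsilon>"
    have "infdist y C \<le> \<delta>" using infdist_triangle[of y C x] x(1) y(3)
      by (simp add: \<delta>_def algebra_simps dist_commute)
    then obtain c where c: "c \<in> C" "dist y c \<le> \<delta>"
      using infdist_attains_inf[OF clC neC, of y] by metis
    have "norm (q y - q c) \<le> norm (y - c)"
    proof -
      have "orthogonal (q y - q c) (p y - p c)"
        using orth p V by (auto simp: q_def intro: subspace_diff)
      then have "(norm ((q y - q c) + (p y - p c)))\<^sup>2 = (norm (q y - q c))\<^sup>2 + (norm (p y - p c))\<^sup>2"
        by (rule norm_add_Pythagorean)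
      then have "(norm (q y - q c))\<^sup>2 \<le> (norm (y - c))\<^sup>2" by (simp add: q_def)
      then show ?thesis using power2_le_imp_le norm_ge_zero by blast
    qed
    then have e: "norm (q y - q c) \<le> \<delta>" using c(2) by (simp add: dist_norm)
    have d0: "\<delta> \<ge> 0" using eps k(1) by (simp add: \<delta>_def)
    \<comment> \<open>Around \<open>s *\<^sub>R x1\<close> the cone contains a ball in its span of
      radius \<open>s * r = \<delta>\<close>, just enough to absorb
      \<open>q y - q c\<close>.\<close>
    define s where "s = \<delta> / r"
    have dsr: "\<delta> = s * r" using r(1) by (simp add: s_def)
    have s0: "s \<ge> 0" using d0 r(1) by (simp add: s_def)
    have qc: "q c \<in> C1" "p c \<in> C2" using c(1) unfolding Ceq by auto
    have qy: "q y \<in> span C1" "p y \<in> C2" using y(1) unfolding Y_def by auto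
    have in1: "q y + s *\<^sub>R x1 \<in> C1"
    proof (cases "s = 0")
      case True
      then have "\<delta> = 0" using r(1) by (simp add: s_def)
      then show ?thesis using True e qc by simp
    next
      case False
      then have s1: "s > 0" using s0 by simp
      have "norm (inverse s *\<^sub>R (q y - q c)) = inverse s * norm (q y - q c)" using s1 by simp
      also have "\<dots> \<le> inverse s * \<delta>" using e s1 by (intro mult_left_mono) auto
      also have "\<dots> = r" using s1 r(1) by (simp add: dsr field_simps)
      finally have "x1 + inverse s *\<^sub>R (q y - q c) \<in> cball x1 r" by (simp add: dist_norm)
      moreover have "x1 + inverse s *\<^sub>R (q y - q c) \<in> span C1"
        using x1C qc qy by (intro span_add span_scale span_diff) (auto intro: span_base)
      ultimately have "x1 + inverse s *\<^sub>R (q y - q c) \<in> C1" using r(2) by blast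
      then have "q c + s *\<^sub>R (x1 + inverse s *\<^sub>R (q y - q c)) \<in> C1"
        using C1'(6,7) qc s0 by blast
      then show ?thesis using s1 by (simp add: algebra_simps)
    qed
    \<comment> \<open>Division by \<open>1 + s\<close> turns the sum into an affine combination of
      \<open>y\<close> and the Slater point, so it stays in \<open>A\<close>; the cone is
      indifferent to the scaling.\<close>
    define w where "w = inverse (1 + s) *\<^sub>R (y + s *\<^sub>R (x1 + x2))"
    have "q w = inverse (1 + s) *\<^sub>R (q y + s *\<^sub>R x1)" "p w = inverse (1 + s) *\<^sub>R (p y + s *\<^sub>R x2)"
      using pqx pqx' by (simp_all add: w_def linear_add[OF q] linear_scale[OF q] linear_add[OF p(1)] linear_scale[OF p(1)])
    then have wC: "w \<in> C" unfolding Ceq using in1 qy s0 C1'(7) C2'(6,7) x2 by simp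
    have comb: "w = inverse (1 + s) *\<^sub>R y + (s * inverse (1 + s)) *\<^sub>R (x1 + x2)"
      by (simp add: w_def algebra_simps)
    have wA: "w \<in> A" unfolding comb using affA y(2) xA s0
      by (intro mem_affine) (auto simp: field_simps)
    have yw: "y - w = (s * inverse (1 + s)) *\<^sub>R (y - (x1 + x2))"
    proof -
      have "inverse (1 + s) + s * inverse (1 + s) = 1" using s0 by (simp add: field_simps)
      then have "y = inverse (1 + s) *\<^sub>R y + (s * inverse (1 + s)) *\<^sub>R y"
        by (simp flip: scaleR_add_left)
      then have "y - w = (inverse (1 + s) *\<^sub>R y + (s * inverse (1 + s)) *\<^sub>R y) - w" by simp
      then show ?thesis unfolding comb by (simp add: scaleR_diff_right)
    qed
    let ?u = "s * inverse (1 + s)"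
    \<comment> \<open>Both upper bounds are needed: \<open>s\<close> makes the main term linear in
      \<open>\<epsilon>\<close>, while \<open>1\<close> in front of \<open>k * \<epsilon>\<close>
      avoids a quadratic term.\<close>
    have u: "0 \<le> ?u" "?u \<le> 1" "?u \<le> s" using s0 by (auto simp: field_simps)
    have "norm y \<le> norm x + k * \<epsilon>" using y(3) norm_triangle_sub[of y x]
      by (simp add: dist_norm norm_minus_commute)
    then have "norm (y - (x1 + x2)) \<le> norm x + norm (x1 + x2) + k * \<epsilon>"
      using norm_triangle_ineq4[of y "x1 + x2"] by linarith
    then have "norm (y - w) \<le> ?u * (norm x + norm (x1 + x2) + k * \<epsilon>)"
      unfolding yw using u by (simp add: mult_left_mono)
    also have "\<dots> = ?u * (norm x + norm (x1 + x2)) + ?u * (k * \<epsilon>)" by (simp add: algebra_simps)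
    also have "\<dots> \<le> s * (norm x + norm (x1 + x2)) + 1 * (k * \<epsilon>)"
      using u k(1) eps by (intro add_mono mult_right_mono) auto
    finally have "norm (y - w) \<le> s * (norm x + norm (x1 + x2)) + k * \<epsilon>" by simp
    then have "dist x w \<le> 2 * k * \<epsilon> + s * (norm x + norm (x1 + x2))"
      using dist_triangle[of x w y] y(3) by (simp add: dist_norm)
    moreover have "s * (norm x + norm (x1 + x2)) \<le> s * ((1 + norm (x1 + x2)) * (norm x + 1))"
      using s0 by (intro mult_left_mono) (auto simp: algebra_simps)
    moreover have "2 * k * \<epsilon> \<le> 2 * k * \<epsilon> * (norm x + 1)"
      using mult_left_mono[of 1 "norm x + 1" "2 * k * \<epsilon>"] k(1) eps by simp
    ultimately have "dist x w \<le> 2 * k * \<epsilon> * (norm x + 1) + s * ((1 + norm (x1 + x2)) * (norm x + 1))"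
      by linarith
    also have "\<dots> = K * (norm x + 1) * \<epsilon>"
    proof -
      define n where "n = norm x + 1"
      define B where "B = 1 + norm (x1 + x2)"
      define h where "h = (1 + k) / r"
      have "s = h * \<epsilon>" by (simp add: s_def \<delta>_def h_def)
      then show ?thesis
        unfolding K_def n_def[symmetric] B_def[symmetric] h_def[symmetric] by (simp add: algebra_simps)
    qed
    finally have "dist x w \<le> K * (norm x + 1) * \<epsilon>" .
    then show ?thesis using wC wA by (intro infdist_le2[of w]) simp_all
  qed
  then show ?thesis using K unfolding A_def by blast
qed

section \<open>Separation of partially polyhedral cones\<close>

lemma mem_orthogonal_comp_singleton: "x \<in> {z}\<^sup>\<bottom> \<longleftrightarrow> z \<bullet> x = 0"
  by (simp add: orthogonal_comp_def orthogonal_def)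

lemma mem_orthogonal_comp: "x \<in> S\<^sup>\<bottom> \<longleftrightarrow> (\<forall>y\<in>S. y \<bullet> x = 0)"
  by (simp add: orthogonal_comp_def orthogonal_def)

lemma infdist_orthogonal_comp_singleton:
  "infdist x ({z}\<^sup>\<bottom>) \<le> \<bar>z \<bullet> x\<bar> / norm z"
proof (cases "z = 0")
  \<comment> \<open>Division by zero makes the right side \<open>0\<close>, and the complement of
    \<open>{0}\<close> is the whole space.\<close>
  case True
  then show ?thesis by simp
next
  case False
  let ?y = "x - ((z \<bullet> x) / (z \<bullet> z)) *\<^sub>R z"
  have "?y \<in> {z}\<^sup>\<bottom>"
    using False by (simp add: mem_orthogonal_comp_singleton inner_diff_right)
  moreover have "dist x ?y = \<bar>z \<bullet> x\<bar> / norm z"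
    using False by (simp add: dist_norm dot_square_norm power2_eq_square)
  ultimately show ?thesis by (metis infdist_le)
qed

lemma convex_cone_set_plus:
  assumes "convex_cone S" "convex_cone T"
  shows "convex_cone (S + T)"
proof -
  have "S + T = (\<Union>x\<in>S. \<Union>y\<in>T. {x + y})" by (auto simp: set_plus_def)
  then show ?thesis using convex_cone_sums[OF assms] by simp
qed

lemma rel_interior_convex_cone_scaleR:
  fixes C :: "'a::euclidean_space set"
  assumes C: "convex_cone C" and x: "x \<in> rel_interior C" and c: "0 < c"
  shows "c *\<^sub>R x \<in> rel_interior C"
proof -
  have "(*\<^sub>R) c ` C = C"
  proof (intro equalityI subsetI)
    fix y assume "y \<in> C"
    then have "inverse c *\<^sub>R y \<in> C" using convex_cone_scaleR[OF C] c by simp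
    then show "y \<in> (*\<^sub>R) c ` C" using c by (intro image_eqI[of _ _ "inverse c *\<^sub>R y"]) auto
  qed (use convex_cone_scaleR[OF C] c in auto)
  then show ?thesis using rel_interior_scaleR[of c C] x c by auto
qed

text \<open>The sum is twice the midpoint of \<open>x\<close> and \<open>y\<close>, and that
  midpoint is relatively interior because \<open>x\<close> is.\<close>

lemma rel_interior_convex_cone_add:
  fixes C :: "'a::euclidean_space set"
  assumes C: "convex_cone C" and x: "x \<in> rel_interior C" and y: "y \<in> C"
  shows "x + y \<in> rel_interior C"
proof -
  have "y - (1/2) *\<^sub>R (y - x) \<in> rel_interior C"
    using C x y by (intro rel_interior_convex_shrink) (auto simp: convex_cone_def)
  then have "2 *\<^sub>R (y - (1/2) *\<^sub>R (y - x)) \<in> rel_interior C"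
    using rel_interior_convex_cone_scaleR[OF C] by simp
  moreover have "2 *\<^sub>R (y - (1/2) *\<^sub>R (y - x)) = x + y" by (simp add: algebra_simps scaleR_2)
  ultimately show ?thesis by simp
qed

text \<open>Separating \<open>0\<close> from \<open>rel_interior T + N\<close> by a vector of the
  span of that set makes the separation proper: a functional vanishing on \<open>T\<close> and
  \<open>N\<close> would be orthogonal to its own span and hence zero.\<close>

lemma convex_cone_separation:
  fixes T N :: "'a::euclidean_space set"
  assumes T: "convex_cone T" and N: "subspace N" and disj: "rel_interior T \<inter> N = {}"
  obtains z where "z \<in> N\<^sup>\<bottom>" "z \<in> dual_cone T" "\<exists>x\<in>T. z \<bullet> x \<noteq> 0"
proof -
  have cT: "convex T" "T \<noteq> {}" using T by (auto simp: convex_cone_def)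
  have ne: "rel_interior T \<noteq> {}" using cT by (simp add: rel_interior_eq_empty)
  then obtain t0 where t0: "t0 \<in> rel_interior T" by blast
  define S where "S = rel_interior T + N"
  have "convex S" unfolding S_def
    using cT N by (intro convex_set_plus) (auto simp: convex_rel_interior subspace_imp_convex)
  moreover have t0S: "t0 \<in> S"
    unfolding S_def using set_plus_intro[OF t0 subspace_0[OF N]] by simp
  moreover have "0 \<notin> S"
  proof
    assume "0 \<in> S"
    then obtain t n where "t \<in> rel_interior T" "n \<in> N" "t + n = 0"
      unfolding S_def by (metis set_plus_elim)
    then have "t \<in> N" using subspace_neg[OF N, of n] by (simp add: eq_neg_iff_add_eq_0[symmetric])
    then show False using disj \<open>t \<in> rel_interior T\<close> by blast
  qed
  ultimately obtain a where a: "a \<in> span S" "a \<noteq> 0" "\<And>x. x \<in> S \<Longrightarrow> 0 \<le> a \<bullet> x"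
    using separating_hyperplane_set_0_inspan[of S] by blast
  have aN: "a \<bullet> n = 0" if "n \<in> N" for n
  proof (rule ccontr)
    assume *: "a \<bullet> n \<noteq> 0"
    \<comment> \<open>The coefficient is chosen so that \<open>a\<close> takes the value
      \<open>-1\<close> here.\<close>
    have "t0 + (- (a \<bullet> t0 + 1) / (a \<bullet> n)) *\<^sub>R n \<in> S"
      unfolding S_def using t0 that N by (intro set_plus_intro subspace_scale) auto
    from a(3)[OF this] * show False by (simp add: inner_add_right)
  qed
  have "rel_interior T \<subseteq> {x. a \<bullet> x \<ge> 0}"
  proof
    fix t assume "t \<in> rel_interior T"
    then have "t + 0 \<in> S" unfolding S_def by (intro set_plus_intro subspace_0 N)
    then show "t \<in> {x. a \<bullet> x \<ge> 0}" using a(3) by auto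
  qed
  then have "closure (rel_interior T) \<subseteq> {x. a \<bullet> x \<ge> 0}"
    by (intro closure_minimal closed_halfspace_ge)
  then have aT: "T \<subseteq> {x. a \<bullet> x \<ge> 0}"
    using convex_closure_rel_interior[OF cT(1)] closure_subset by blast
  have "\<exists>x\<in>T. a \<bullet> x \<noteq> 0"
  proof (rule ccontr)
    assume "\<not> (\<exists>x\<in>T. a \<bullet> x \<noteq> 0)"
    then have "a \<bullet> (t + n) = 0" if "t \<in> rel_interior T" "n \<in> N" for t n
      using aN[OF that(2)] that(1) rel_interior_subset[of T] by (auto simp: inner_add_right)
    then have "S \<subseteq> {x. a \<bullet> x = 0}" unfolding S_def by (auto elim!: set_plus_elim)
    then have "span S \<subseteq> {x. a \<bullet> x = 0}" by (intro span_minimal subspace_hyperplane)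
    then show False using a(1,2) by auto
  qed
  then show ?thesis using aN aT
    by (intro that[of a]) (auto simp: mem_orthogonal_comp dual_cone_def inner_commute)
qed

text \<open>
  A separating functional that vanishes on \<open>C1\<close> cuts \<open>C2\<close> down to a smaller polyhedral cone.
  A functional for the smaller cone is corrected by a large multiple of the first one, which
  Hoffman's bound permits.
\<close>

lemma partially_polyhedral_separation:
  fixes C1 C2 N :: "'a::euclidean_space set"
  assumes C1: "convex_cone C1" and N: "subspace N"
    and "convex_cone C2" "polyhedron C2" "(rel_interior C1 + C2) \<inter> N = {}"
  shows "\<exists>z. z \<in> N\<^sup>\<bottom> \<and> z \<in> dual_cone (C1 + C2) \<and> (\<exists>x\<in>C1. z \<bullet> x \<noteq> 0)"
  using assms(3-5)
proof (induction "dim C2" arbitrary: C2 rule: less_induct)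
  case less
  note C2 = less.prems
  have cv: "convex C1" "convex C2" using C1 C2(1) by (auto simp: convex_cone_def)
  have zero: "0 \<in> C1" "0 \<in> C2" using C1 C2(1) convex_cone_contains_0 by auto
  have inT: "C1 \<subseteq> C1 + C2" "C2 \<subseteq> C1 + C2"
    using set_plus_intro[OF zero(1)] set_plus_intro[OF _ zero(2)] by force+
  have "rel_interior (C1 + C2) \<subseteq> rel_interior C1 + C2"
    unfolding rel_interior_sum[OF cv] using rel_interior_subset[of C2] by (rule set_plus_mono2[OF order_refl])
  then have "rel_interior (C1 + C2) \<inter> N = {}" using C2(3) by blast
  from convex_cone_separation[OF convex_cone_set_plus[OF C1 C2(1)] N this]
  obtain z where z: "z \<in> N\<^sup>\<bottom>" "z \<in> dual_cone (C1 + C2)" "\<exists>x\<in>C1 + C2. z \<bullet> x \<noteq> 0" by blast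
  show ?case
  proof (cases "\<exists>x\<in>C1. z \<bullet> x \<noteq> 0")
    case True
    then show ?thesis using z by blast
  next
    case False
    then obtain c where c: "c \<in> C2" "z \<bullet> c \<noteq> 0"
      using z(3) by (auto elim!: set_plus_elim simp: inner_add_right)
    then have z0: "z \<noteq> 0" by auto
    define D where "D = C2 \<inter> {z}\<^sup>\<bottom>"
    have hyp: "{z}\<^sup>\<bottom> = {x. z \<bullet> x = 0}" by (auto simp: mem_orthogonal_comp_singleton)
    have "span D \<subseteq> {x. z \<bullet> x = 0}"
      by (intro span_minimal subspace_hyperplane) (auto simp: D_def hyp)
    then have "c \<notin> span D" using c by auto
    moreover have "span D \<subseteq> span C2" by (intro span_mono) (auto simp: D_def)
    ultimately have "span D \<subset> span C2" using c(1) span_base by blast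
    then have dim: "dim D < dim C2" by (rule dim_psubset)
    have ccD: "convex_cone D"
      using convex_cone_Inter[of "{C2, {z}\<^sup>\<bottom>}"] C2(1) subspace_imp_convex_cone[OF subspace_orthogonal_comp]
      by (auto simp: D_def)
    have pz: "polyhedron ({z}\<^sup>\<bottom>)" by (intro polyhedron_subspace subspace_orthogonal_comp)
    have pD: "polyhedron D" unfolding D_def using C2(2) pz by (rule polyhedron_Int)
    have "(rel_interior C1 + D) \<inter> N = {}"
      using C2(3) set_plus_mono2[OF order_refl, of D C2 "rel_interior C1"] by (auto simp: D_def)
    from less.hyps[OF dim ccD pD this]
    obtain z' where z': "z' \<in> N\<^sup>\<bottom>" "z' \<in> dual_cone (C1 + D)" "\<exists>x\<in>C1. z' \<bullet> x \<noteq> 0" by blast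
    have D0: "0 \<in> D" using ccD convex_cone_contains_0 by blast
    then have ne: "C2 \<inter> {z}\<^sup>\<bottom> \<noteq> {}" by (auto simp: D_def)
    from polyhedra_linear_regularity[OF C2(2) pz ne]
    obtain k where k: "k > 0"
      "\<And>x d. infdist x C2 \<le> d \<Longrightarrow> infdist x ({z}\<^sup>\<bottom>) \<le> d \<Longrightarrow> infdist x D \<le> k * d"
      unfolding D_def by blast
    \<comment> \<open>A point \<open>x\<close> of \<open>C2\<close> is within
      \<open>k * (z \<bullet> x) / norm z\<close> of \<open>D\<close>, where \<open>z'\<close> is
      nonnegative. So \<open>z' \<bullet> x\<close> is at least
      \<open>- t * (z \<bullet> x)\<close>, which \<open>t *\<^sub>R z\<close> compensates.\<close>
    define t where "t = norm z' * k / norm z"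
    define w where "w = z' + t *\<^sub>R z"
    have wN: "w \<in> N\<^sup>\<bottom>" unfolding w_def
      using z(1) z'(1) by (intro subspace_add subspace_scale subspace_orthogonal_comp)
    have w1: "w \<bullet> x = z' \<bullet> x" if "x \<in> C1" for x
      using False that by (simp add: w_def inner_add_left)
    have w1pos: "0 \<le> w \<bullet> x" if "x \<in> C1" for x
    proof -
      have "x + 0 \<in> C1 + D" using that D0 by (rule set_plus_intro)
      then show ?thesis using z'(2) w1[OF that] by (simp add: dual_cone_def)
    qed
    have w2pos: "0 \<le> w \<bullet> x" if x: "x \<in> C2" for x
    proof -
      have zx: "0 \<le> z \<bullet> x" using z(2) inT(2) x by (auto simp: dual_cone_def)
      have "infdist x D \<le> k * ((z \<bullet> x) / norm z)"
        using infdist_orthogonal_comp_singleton[of x z] zx x by (intro k(2)) auto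
      moreover obtain y where "y \<in> D" "infdist x D = dist x y"
        using infdist_attains_inf[of D x] polyhedron_imp_closed[OF pD] D0 by blast
      ultimately have y: "y \<in> D" "dist x y \<le> k * ((z \<bullet> x) / norm z)" by simp_all
      have "0 + y \<in> C1 + D" using zero(1) y(1) by (rule set_plus_intro)
      then have "0 \<le> z' \<bullet> y" using z'(2) by (simp add: dual_cone_def)
      also have "\<dots> = z' \<bullet> x + z' \<bullet> (y - x)" by (simp add: inner_diff_right)
      finally have "0 \<le> z' \<bullet> x + z' \<bullet> (y - x)" .
      moreover have "z' \<bullet> (y - x) \<le> norm z' * dist x y"
        unfolding dist_norm using norm_cauchy_schwarz[of z' "y - x"] by (simp add: norm_minus_commute)
      moreover have "norm z' * dist x y \<le> norm z' * (k * ((z \<bullet> x) / norm z))"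
        using y(2) by (intro mult_left_mono) auto
      moreover have "norm z' * (k * ((z \<bullet> x) / norm z)) = t * (z \<bullet> x)" by (simp add: t_def)
      ultimately show ?thesis by (simp add: w_def inner_add_left)
    qed
    have "w \<in> dual_cone (C1 + C2)"
      using w1pos w2pos by (auto simp: dual_cone_def inner_add_right elim!: set_plus_elim)
    moreover have "\<exists>x\<in>C1. w \<bullet> x \<noteq> 0" using w1 z'(3) by auto
    ultimately show ?thesis using wN by blast
  qed
qed

text \<open>The affine space is replaced by its linear span \<open>N\<close>, to which separation
  applies. A common point of \<open>N\<close> and \<open>rel_interior C1 + C2\<close> would yield
  one in the affine space: adding a multiple of the feasible point makes the coefficient of
  \<open>b\<close> positive, and dividing by it stays in the cone.\<close>

lemma facial_reduction_step:
  fixes C1 C2 M :: "'a::euclidean_space set"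
  assumes C1: "convex_cone C1" and C2: "convex_cone C2" "polyhedron C2" and M: "subspace M"
    and feas: "(C1 + C2) \<inter> (+) b ` M \<noteq> {}"
    and disj: "(rel_interior C1 + C2) \<inter> (+) b ` M = {}"
  shows "\<exists>z. z \<in> dual_cone (C1 + C2) \<inter> M\<^sup>\<bottom> \<inter> {b}\<^sup>\<bottom> \<and> (\<exists>x\<in>C1. z \<bullet> x \<noteq> 0)"
proof -
  define N where "N = span (insert b M)"
  obtain u v m where u: "u \<in> C1" "v \<in> C2" "m \<in> M" "u + v = b + m"
    using feas by (auto elim!: set_plus_elim)
  have spM: "span M = M" using M by (simp only: span_eq_iff)
  have "(rel_interior C1 + C2) \<inter> N = {}"
  proof (rule ccontr)
    assume "(rel_interior C1 + C2) \<inter> N \<noteq> {}"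
    then obtain r c where rc: "r \<in> rel_interior C1" "c \<in> C2" "r + c \<in> span (insert b M)"
      unfolding N_def by (auto elim!: set_plus_elim)
    obtain k where "r + c - k *\<^sub>R b \<in> M"
      using rc(3) unfolding span_breakdown_eq spM by blast
    with rc(1,2) have r: "r \<in> rel_interior C1" "c \<in> C2" "r + c - k *\<^sub>R b \<in> M" by auto
    \<comment> \<open>Large enough to make \<open>k + s\<close> positive whatever the sign of
      \<open>k\<close>.\<close>
    define s where "s = \<bar>k\<bar> + 1"
    have s: "s \<ge> 0" "k + s > 0" unfolding s_def by auto
    let ?r = "inverse (k + s) *\<^sub>R (r + s *\<^sub>R u)" and ?c = "inverse (k + s) *\<^sub>R (c + s *\<^sub>R v)"
    have "?r \<in> rel_interior C1"
      using s u(1) r(1) C1 convex_cone_scaleR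
      by (intro rel_interior_convex_cone_scaleR rel_interior_convex_cone_add) auto
    moreover have "?c \<in> C2"
      using s u(2) r(2) C2(1) by (intro convex_cone_scaleR convex_cone_add) auto
    ultimately have in1: "?r + ?c \<in> rel_interior C1 + C2" by (rule set_plus_intro)
    have "?r + ?c = inverse (k + s) *\<^sub>R ((r + c - k *\<^sub>R b) + s *\<^sub>R (u + v) + k *\<^sub>R b)"
      by (simp add: algebra_simps)
    also have "\<dots> = inverse (k + s) *\<^sub>R ((k + s) *\<^sub>R b + ((r + c - k *\<^sub>R b) + s *\<^sub>R m))"
      unfolding u(4) by (simp add: algebra_simps)
    also have "\<dots> = b + inverse (k + s) *\<^sub>R ((r + c - k *\<^sub>R b) + s *\<^sub>R m)"
      using s(2) by (simp add: scaleR_add_right[of _ "(k + s) *\<^sub>R b"] del: scaleR_add_left)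
    also have "\<dots> \<in> (+) b ` M"
      using r(3) u(3) M by (intro imageI subspace_scale subspace_add)
    finally have "?r + ?c \<in> (+) b ` M" .
    then show False using in1 disj by blast
  qed
  from partially_polyhedral_separation[OF C1 _ C2 this]
  obtain z where z: "z \<in> N\<^sup>\<bottom>" "z \<in> dual_cone (C1 + C2)" "\<exists>x\<in>C1. z \<bullet> x \<noteq> 0"
    unfolding N_def by auto
  have "insert b M \<subseteq> N" unfolding N_def by (rule span_superset)
  then have "z \<in> (insert b M)\<^sup>\<bottom>" using z(1) orthogonal_comp_anti_mono by blast
  then show ?thesis using z(2,3) by (intro exI[of _ z]) (auto simp: mem_orthogonal_comp)
qed

section \<open>Faces and facial residual functions\<close>

lemma cone_face_refl: "convex_cone K \<Longrightarrow> cone_face K K"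
  by (simp add: cone_face_def)

lemma cone_face_trans: "cone_face F G \<Longrightarrow> cone_face G K \<Longrightarrow> cone_face F K"
  unfolding cone_face_def by blast

lemma cone_face_subset: "cone_face F K \<Longrightarrow> F \<subseteq> K"
  by (simp add: cone_face_def)

lemma cone_face_closed_convex_cone:
  assumes "closed_convex_cone K" "cone_face F K"
  shows "closed_convex_cone F"
proof -
  note K = closed_convex_coneD[OF assms(1)]
  have "F face_of K" using assms(2) cone_face_iff_face_of[OF K(2)] by blast
  then have "closed F" using K(1,3) face_of_imp_closed by blast
  then show ?thesis using assms(2) by (simp add: closed_convex_cone_def cone_face_def)
qed

lemma cone_face_exposed:
  assumes F: "convex_cone F" and z: "z \<in> dual_cone F"
  shows "cone_face (F \<inter> {z}\<^sup>\<bottom>) F"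
  unfolding cone_face_def
proof (intro conjI ballI impI)
  show "convex_cone (F \<inter> {z}\<^sup>\<bottom>)"
    using convex_cone_Inter[of "{F, {z}\<^sup>\<bottom>}"] F
      subspace_imp_convex_cone[OF subspace_orthogonal_comp] by auto
  fix x y assume xy: "x \<in> F" "y \<in> F" "x + y \<in> F \<inter> {z}\<^sup>\<bottom>"
  then have "z \<bullet> x + z \<bullet> y = 0" by (simp add: mem_orthogonal_comp_singleton inner_add_right)
  moreover have "0 \<le> z \<bullet> x" "0 \<le> z \<bullet> y" using z xy by (auto simp: dual_cone_def)
  ultimately show "x \<in> F \<inter> {z}\<^sup>\<bottom>" "y \<in> F \<inter> {z}\<^sup>\<bottom>"
    using xy by (auto simp: mem_orthogonal_comp_singleton)
qed auto

lemma reduction_direction_vanishes: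
  assumes "z \<in> M\<^sup>\<bottom> \<inter> {b}\<^sup>\<bottom>" "x \<in> (+) b ` M"
  shows "z \<bullet> x = 0"
  using assms by (auto simp: mem_orthogonal_comp inner_add_right inner_commute)

text \<open>Every \<open>z i\<close> vanishes on the affine space, so its hyperplane removes no
  feasible point, and exposed faces of faces are faces.\<close>

lemma reduction_sequence_face:
  assumes K: "convex_cone K" and red: "reduction_sequence K M b F z k" and i: "1 \<le> i" "i \<le> Suc k"
  shows "cone_face (F i) K \<and> F i \<inter> (+) b ` M = K \<inter> (+) b ` M"
  using i
proof (induction i rule: dec_induct)
  case base
  then show ?case using red cone_face_refl[OF K] by (simp add: reduction_sequence_def)
next
  case (step i)
  then have IH: "cone_face (F i) K" "F i \<inter> (+) b ` M = K \<inter> (+) b ` M" by auto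
  have z: "z i \<in> dual_cone (F i)" "z i \<in> M\<^sup>\<bottom> \<inter> {b}\<^sup>\<bottom>" and F: "F (Suc i) = F i \<inter> {z i}\<^sup>\<bottom>"
    using red step.hyps step.prems by (auto simp: reduction_sequence_def)
  have "convex_cone (F i)" using IH(1) by (simp add: cone_face_def)
  from cone_face_trans[OF cone_face_exposed[OF this z(1)] IH(1)]
  have "cone_face (F (Suc i)) K" by (simp add: F)
  moreover have "x \<in> {z i}\<^sup>\<bottom>" if "x \<in> (+) b ` M" for x
    using reduction_direction_vanishes[OF z(2) that] by (simp add: mem_orthogonal_comp_singleton)
  then have "F (Suc i) \<inter> (+) b ` M = F i \<inter> (+) b ` M" unfolding F by blast
  ultimately show ?case using IH(2) by simp
qed

text \<open>
  Moving from \<open>0\<close> along an element of the face outside the hyperplane violates the residual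
  conditions only linearly.
\<close>

lemma facial_residual_function_lower_bound:
  fixes K F :: "'a::euclidean_space set"
  assumes frf: "facial_residual_function K F z \<psi>" and F: "closed_convex_cone F"
    and FK: "F \<subseteq> K" and strict: "F \<inter> {z}\<^sup>\<bottom> \<subset> F"
  shows "\<exists>c>0. \<forall>s\<ge>0. \<forall>t\<ge>0. c * min s t \<le> \<psi> s t"
proof -
  note F' = closed_convex_coneD[OF F]
  define G where "G = F \<inter> {z}\<^sup>\<bottom>"
  have G: "closed_convex_cone G" unfolding G_def using F
    by (intro closed_convex_cone_Int)
       (auto simp: closed_convex_cone_def closed_subspace subspace_orthogonal_comp subspace_imp_convex_cone)
  note G' = closed_convex_coneD[OF G]
  obtain u0 where u0: "u0 \<in> F" "u0 \<notin> G" using strict unfolding G_def by blast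
  \<comment> \<open>This normalization gives \<open>norm u \<le> 1\<close> and
    \<open>u \<bullet> z \<le> 1\<close>, so that \<open>r *\<^sub>R u\<close> meets the residual
    conditions at level \<open>r\<close>.\<close>
  define m where "m = inverse (1 + norm u0 + \<bar>u0 \<bullet> z\<bar>)"
  have m: "m > 0" unfolding m_def by (intro positive_imp_inverse_positive) (smt (verit) norm_ge_zero abs_ge_zero)
  define u where "u = m *\<^sub>R u0"
  have uF: "u \<in> F" using u0 m F'(7) by (simp add: u_def)
  have uG: "u \<notin> G"
  proof
    assume "u \<in> G"
    then have "inverse m *\<^sub>R u \<in> G" using G'(7) m by simp
    then show False using u0(2) m by (simp add: u_def)
  qed
  have den: "0 < 1 + norm u0 + \<bar>u0 \<bullet> z\<bar>" by (smt (verit) norm_ge_zero abs_ge_zero)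
  have "norm u \<le> 1" "u \<bullet> z \<le> 1"
    using m den by (auto simp: u_def m_def field_simps) (smt (verit) norm_ge_zero abs_ge_zero)+
  note u1 = this
  define c where "c = infdist u G"
  have c: "c > 0" unfolding c_def using infdist_pos_not_in_closed[OF G'(1,5) uG] .
  have scale: "r * c \<le> infdist (r *\<^sub>R u) G" if r: "r \<ge> 0" for r
  proof (cases "r = 0")
    case True
    then show ?thesis by (simp add: infdist_nonneg)
  next
    case False
    then have r0: "r > 0" using r by simp
    have "r * c \<le> dist (r *\<^sub>R u) y" if y: "y \<in> G" for y
    proof -
      have "inverse r *\<^sub>R y \<in> G" using G'(7) y r0 by simp
      then have "r * c \<le> r * dist u (inverse r *\<^sub>R y)" unfolding c_def
        using r0 by (intro mult_left_mono infdist_le) auto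
      also have "\<dots> = norm (r *\<^sub>R (u - inverse r *\<^sub>R y))" using r0 by (simp add: dist_norm)
      also have "\<dots> = dist (r *\<^sub>R u) y" using r0 by (simp add: dist_norm scaleR_diff_right)
      finally show ?thesis .
    qed
    then show ?thesis unfolding infdist_notempty[OF G'(5)] by (intro cINF_greatest G'(5))
  qed
  have "c * min s t \<le> \<psi> s t" if st: "s \<ge> 0" "t \<ge> 0" for s t
  proof -
    \<comment> \<open>Monotonicity needs \<open>r \<le> s\<close> in the first argument and
      \<open>norm x \<le> t\<close> in the second; the minimum serves both.\<close>
    define r where "r = min s t"
    have r: "r \<ge> 0" "r \<le> s" "r \<le> t" using st by (auto simp: r_def)
    define x where "x = r *\<^sub>R u"
    have xF: "x \<in> F" using uF r F'(7) by (simp add: x_def)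
    have nx: "norm x \<le> r" using r u1 mult_left_mono[of "norm u" 1 r] by (simp add: x_def)
    have xz: "x \<bullet> z \<le> r" using r u1 mult_left_mono[of "u \<bullet> z" 1 r] by (simp add: x_def)
    have "x \<in> span K" using xF FK span_base by blast
    moreover have "infdist x K = 0" "infdist x (span F) = 0"
      using xF FK by (auto intro!: infdist_zero span_base)
    ultimately have "infdist x G \<le> \<psi> r (norm x)"
      using frf r xz unfolding facial_residual_function_def G_def by auto
    also have "\<dots> \<le> \<psi> r t"
      using frf r nx unfolding facial_residual_function_def mono_on_def by auto
    also have "\<dots> \<le> \<psi> s t"
      using frf r st unfolding facial_residual_function_def mono_on_def by auto
    finally show ?thesis using scale[OF r(1)] by (simp add: x_def r_def mult.commute)
  qed
  then show ?thesis using c by blast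
qed

section \<open>Composition of residual functions along a chain\<close>

lemma diamonds_Suc:
  "1 \<le> k \<Longrightarrow> diamonds \<psi> (Suc k) s t = \<psi> (Suc k) (s + diamonds \<psi> k s t) t"
  by (cases k) (simp_all add: diamond_def)

lemma diamonds_cong:
  assumes "\<And>i. 1 \<le> i \<Longrightarrow> i \<le> k \<Longrightarrow> \<psi> i = \<psi>' i"
  shows "diamonds \<psi> k = diamonds \<psi>' k"
  using assms by (induction \<psi> k rule: diamonds.induct) simp_all

text \<open>Right nesting puts the last residual function outermost. Its value feeds no other one,
  so a factor in front of it is a factor of the whole composition.\<close>

lemma diamonds_rescale_last:
  assumes n: "1 \<le> n" and B: "0 < B" and resc: "\<forall>i\<in>{1..n}. positive_rescaling (\<psi> i) (\<psi>' i)"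
  shows "\<exists>\<psi>''. (\<forall>i\<in>{1..n}. positive_rescaling (\<psi> i) (\<psi>'' i)) \<and>
            (\<forall>s t. diamonds \<psi>'' n s t = B * diamonds \<psi>' n s t)"
proof -
  define \<psi>'' where "\<psi>'' = \<psi>'(n := \<lambda>s t. B * \<psi>' n s t)"
  have "positive_rescaling (\<psi> i) (\<psi>'' i)" if i: "i \<in> {1..n}" for i
  proof (cases "i = n")
    case True
    obtain M1 M2 M3 where M: "M1 > 0" "M2 > 0" "M3 > 0" "\<psi>' n = (\<lambda>s t. M3 * \<psi> n (M1 * s) (M2 * t))"
      using resc i True unfolding positive_rescaling_def by blast
    then have "\<psi>'' n = (\<lambda>s t. (B * M3) * \<psi> n (M1 * s) (M2 * t))" by (simp add: \<psi>''_def mult.assoc)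
    moreover have "B * M3 > 0" using B M(3) by simp
    ultimately show ?thesis unfolding True positive_rescaling_def using M(1,2) by blast
  next
    case False
    then show ?thesis using resc i by (simp add: \<psi>''_def)
  qed
  moreover have "diamonds \<psi>'' n s t = B * diamonds \<psi>' n s t" for s t
  proof (cases "n = 1")
    case True
    then show ?thesis by (simp add: \<psi>''_def)
  next
    case False
    then obtain k where k: "n = Suc k" "1 \<le> k" using n by (cases n) auto
    have "diamonds \<psi>'' k = diamonds \<psi>' k" by (rule diamonds_cong) (simp add: \<psi>''_def k)
    then show ?thesis unfolding k(1) diamonds_Suc[OF k(2)] by (simp add: \<psi>''_def k(1))
  qed
  ultimately show ?thesis by blast
qed

text \<open>The three lower bounds on \<open>s\<close> match the three residual conditions: distance
  to \<open>K\<close>, value of \<open>z\<close> (at most \<open>norm z\<close> times the distance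
  to the affine space) and distance to \<open>span F\<close>. The factors \<open>2\<close>
  anticipate the points \<open>(x, x)\<close>.\<close>

lemma facial_residual_step:
  fixes K F M :: "'a::euclidean_space set"
  assumes frf: "facial_residual_function K F z \<psi>" and z: "z \<in> M\<^sup>\<bottom> \<inter> {b}\<^sup>\<bottom>"
    and M: "subspace M" and ne: "F \<noteq> {}"
    and x: "x \<in> span K" "infdist x K \<le> 2 * \<epsilon>" "infdist x ((+) b ` M) \<le> 2 * \<epsilon>" "norm x \<le> 2 * t"
    and F: "infdist x F \<le> \<delta>" and s: "2 * \<epsilon> \<le> s" "2 * \<epsilon> * norm z \<le> s" "\<delta> \<le> s"
  shows "infdist x (F \<inter> {z}\<^sup>\<bottom>) \<le> \<psi> s (2 * t)"
proof -
  have "z \<bullet> x - 0 \<le> norm z * infdist x ((+) b ` M)"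
    using reduction_direction_vanishes[OF z] subspace_0[OF M]
    by (intro inner_le_infdist_halfspace) force+
  also have "\<dots> \<le> norm z * (2 * \<epsilon>)" using x(3) by (intro mult_left_mono) auto
  finally have "x \<bullet> z \<le> s" using s(2) by (simp add: inner_commute mult.commute)
  moreover have "infdist x (span F) \<le> s"
    using infdist_mono[OF span_superset ne, of x] F s(3) by linarith
  moreover have s0: "0 \<le> s" using F infdist_nonneg[of x F] s(3) by linarith
  moreover have "infdist x K \<le> s" using x(2) s(1) by linarith
  ultimately have "infdist x (F \<inter> {z}\<^sup>\<bottom>) \<le> \<psi> s (norm x)"
    using frf x(1) unfolding facial_residual_function_def by blast
  also have "\<dots> \<le> \<psi> s (2 * t)"
    using frf s0 x(4) norm_ge_zero[of x] unfolding facial_residual_function_def mono_on_def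
    by (meson atLeast_iff order_trans)
  finally show ?thesis .
qed

text \<open>The argument \<open>\<epsilon> + g\<close> of each composition carries what the next
  step needs: \<open>\<epsilon>\<close> for the cone and the affine space, and the previous value
  \<open>g\<close> for the current face. The lower bound comes from the outermost function alone,
  whose first argument is at least \<open>\<epsilon>\<close>.\<close>

lemma facial_residual_chain:
  fixes K M :: "'a::euclidean_space set"
  assumes K: "closed_convex_cone K" and M: "subspace M"
    and red: "reduction_sequence K M b F z n" and n: "1 \<le> n" and strict: "F (Suc n) \<subset> F n"
    and frf: "\<forall>i\<in>{1..n}. facial_residual_function K (F i) (z i) (\<psi> i)"
  obtains \<psi>' c where "\<forall>i\<in>{1..n}. positive_rescaling (\<psi> i) (\<psi>' i)"
    "0 < c" "\<And>\<epsilon> t. 0 \<le> \<epsilon> \<Longrightarrow> 0 \<le> t \<Longrightarrow> c * min \<epsilon> t \<le> diamonds \<psi>' n \<epsilon> t"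
    "\<And>x \<epsilon> t. x \<in> span K \<Longrightarrow> infdist x K \<le> 2 * \<epsilon> \<Longrightarrow> infdist x ((+) b ` M) \<le> 2 * \<epsilon> \<Longrightarrow>
       norm x \<le> 2 * t \<Longrightarrow> infdist x (F (Suc n)) \<le> diamonds \<psi>' n \<epsilon> t"
proof -
  \<comment> \<open>The scaled argument must dominate both \<open>2 * \<epsilon>\<close> and
    \<open>2 * \<epsilon> * norm (z i)\<close>.\<close>
  define m where "m i = 2 + 2 * norm (z i)" for i
  have m: "2 \<le> m i" "2 * norm (z i) \<le> m i" for i by (auto simp: m_def)
  define \<psi>' where "\<psi>' i = (\<lambda>s t. 1 * \<psi> i (m i * s) (2 * t))" for i
  have \<psi>': "\<psi>' i s t = \<psi> i (m i * s) (2 * t)" for i s t by (simp add: \<psi>'_def)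
  have resc: "positive_rescaling (\<psi> i) (\<psi>' i)" for i
    unfolding positive_rescaling_def \<psi>'_def
    by (rule exI[of _ "m i"], intro conjI, use m[of i] in linarith)
       (rule exI[of _ 2], simp, rule exI[of _ 1], simp)
  have fc: "closed_convex_cone (F i)" "F i \<subseteq> K" "F i \<noteq> {}" if "1 \<le> i" "i \<le> Suc n" for i
    using reduction_sequence_face[OF closed_convex_coneD(2)[OF K] red that] cone_face_closed_convex_cone[OF K]
      closed_convex_coneD(5) cone_face_subset by blast+
  have zi: "z i \<in> M\<^sup>\<bottom> \<inter> {b}\<^sup>\<bottom>" "F (Suc i) = F i \<inter> {z i}\<^sup>\<bottom>" if "1 \<le> i" "i \<le> n" for i
    using red that by (auto simp: reduction_sequence_def)
  have F1: "F 1 = K" using red by (simp add: reduction_sequence_def)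
  have nonneg: "0 \<le> \<psi> i s t" if "1 \<le> i" "i \<le> n" "0 \<le> s" "0 \<le> t" for i s t
    using frf that by (simp add: facial_residual_function_def)
  have dnonneg: "0 \<le> diamonds \<psi>' i \<epsilon> t" if "1 \<le> i" "i \<le> n" "0 \<le> \<epsilon>" "0 \<le> t" for i \<epsilon> t
    using that(1,2)
  proof (induction i rule: dec_induct)
    case base
    then show ?case using nonneg that m[of 1] by (simp add: \<psi>')
  next
    case (step i)
    define g where "g = diamonds \<psi>' i \<epsilon> t"
    have "0 \<le> g" unfolding g_def using step by auto
    then have "0 \<le> m (Suc i) * (\<epsilon> + g)" using m(1)[of "Suc i"] that(3) by simp
    then have "0 \<le> \<psi>' (Suc i) (\<epsilon> + g) t"
      unfolding \<psi>' using step that(4) by (intro nonneg) auto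
    then show ?case unfolding diamonds_Suc[OF step(1)] g_def .
  qed
  have est: "infdist x (F (Suc i)) \<le> diamonds \<psi>' i \<epsilon> t"
    if i: "1 \<le> i" "i \<le> n" and x: "x \<in> span K" "infdist x K \<le> 2 * \<epsilon>"
      "infdist x ((+) b ` M) \<le> 2 * \<epsilon>" "norm x \<le> 2 * t" for x \<epsilon> t i
  proof -
    have e0: "0 \<le> \<epsilon>" using x(2) infdist_nonneg[of x K] by linarith
    have t0: "0 \<le> t" using x(4) norm_ge_zero[of x] by linarith
    from i show ?thesis
    proof (induction i rule: dec_induct)
      case base
      have F1x: "infdist x (F 1) \<le> 2 * \<epsilon>" using x(2) by (simp only: F1)
      have le: "2 * \<epsilon> \<le> m 1 * \<epsilon>" "2 * \<epsilon> * norm (z 1) \<le> m 1 * \<epsilon>"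
        using mult_right_mono[OF m(1)[of 1] e0] mult_right_mono[OF m(2)[of 1] e0]
        by (simp_all add: mult_ac)
      have i: "1 \<le> Suc n" "(1::nat) \<le> 1" by auto
      have "facial_residual_function K (F 1) (z 1) (\<psi> 1)" using frf n by simp
      from facial_residual_step[OF this zi(1)[OF i(2) n] M fc(3)[OF i(2,1)] x F1x le le(1)]
      have "infdist x (F 1 \<inter> {z 1}\<^sup>\<bottom>) \<le> \<psi> 1 (m 1 * \<epsilon>) (2 * t)" .
      then show ?case using zi(2)[of 1] n by (simp add: \<psi>')
    next
      case (step i)
      define g where "g = diamonds \<psi>' i \<epsilon> t"
      have g: "0 \<le> g" unfolding g_def using step.hyps step.prems e0 t0 by (intro dnonneg) auto
      have IH: "infdist x (F (Suc i)) \<le> g" unfolding g_def using step by auto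
      let ?m = "m (Suc i)"
      have "2 * (\<epsilon> + g) \<le> ?m * (\<epsilon> + g)" "2 * norm (z (Suc i)) * (\<epsilon> + g) \<le> ?m * (\<epsilon> + g)"
        using mult_right_mono[OF m(1)[of "Suc i"], of "\<epsilon> + g"]
          mult_right_mono[OF m(2)[of "Suc i"], of "\<epsilon> + g"] e0 g by simp_all
      moreover have "2 * norm (z (Suc i)) * \<epsilon> \<le> 2 * norm (z (Suc i)) * (\<epsilon> + g)"
        using g by (intro mult_left_mono) auto
      ultimately have le: "2 * \<epsilon> \<le> ?m * (\<epsilon> + g)" "2 * \<epsilon> * norm (z (Suc i)) \<le> ?m * (\<epsilon> + g)"
        "g \<le> ?m * (\<epsilon> + g)"
        using e0 g by (simp_all add: mult_ac)
      have i: "1 \<le> Suc i" "Suc i \<le> n" "Suc i \<le> Suc n" using step.prems by auto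
      have "facial_residual_function K (F (Suc i)) (z (Suc i)) (\<psi> (Suc i))" using frf i by simp
      from facial_residual_step[OF this zi(1)[OF i(1,2)] M fc(3)[OF i(1,3)] x IH le]
      have "infdist x (F (Suc i) \<inter> {z (Suc i)}\<^sup>\<bottom>) \<le> \<psi> (Suc i) (?m * (\<epsilon> + g)) (2 * t)" .
      also have "\<dots> = \<psi>' (Suc i) (\<epsilon> + g) t" unfolding \<psi>' ..
      finally show ?case
        using zi(2)[of "Suc i"] step.prems unfolding diamonds_Suc[OF step.hyps(1)] g_def by simp
    qed
  qed
  from strict zi(2)[of n] n have st: "F n \<inter> {z n}\<^sup>\<bottom> \<subset> F n" by simp
  have "facial_residual_function K (F n) (z n) (\<psi> n)" using frf n by simp
  from facial_residual_function_lower_bound[OF this fc(1,2) st] n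
  obtain c where c: "c > 0" "\<And>s t. 0 \<le> s \<Longrightarrow> 0 \<le> t \<Longrightarrow> c * min s t \<le> \<psi> n s t" by auto
  have "c * min \<epsilon> t \<le> diamonds \<psi>' n \<epsilon> t" if et: "0 \<le> \<epsilon>" "0 \<le> t" for \<epsilon> t
  proof -
    \<comment> \<open>\<open>g\<close> is the inner composition, or \<open>0\<close> if there is
      only one step; only its sign matters.\<close>
    obtain g where g: "0 \<le> g" "diamonds \<psi>' n \<epsilon> t = \<psi> n (m n * (\<epsilon> + g)) (2 * t)"
    proof (cases "n = 1")
      case True
      then show ?thesis using that[of 0] by (simp add: \<psi>')
    next
      case False
      then obtain k where k: "n = Suc k" "1 \<le> k" using n by (cases n) auto
      have "diamonds \<psi>' n \<epsilon> t = \<psi>' n (\<epsilon> + diamonds \<psi>' k \<epsilon> t) t"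
        unfolding k(1) using k(2) by (rule diamonds_Suc)
      then show ?thesis using that[OF dnonneg[of k \<epsilon> t]] k et unfolding \<psi>' by simp
    qed
    have "2 * (\<epsilon> + g) \<le> m n * (\<epsilon> + g)" using m(1) g et by (intro mult_right_mono) auto
    moreover have "\<epsilon> \<le> 2 * (\<epsilon> + g)" using et g by simp
    ultimately have "\<epsilon> \<le> m n * (\<epsilon> + g)" by (rule order_trans[rotated])
    then have "c * min \<epsilon> t \<le> c * min (m n * (\<epsilon> + g)) (2 * t)"
      using c(1) et by (intro mult_left_mono) auto
    also have "\<dots> \<le> \<psi> n (m n * (\<epsilon> + g)) (2 * t)"
      using \<open>\<epsilon> \<le> m n * (\<epsilon> + g)\<close> et by (intro c(2)) auto
    finally show ?thesis using g(2) by simp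
  qed
  then show ?thesis using that[of \<psi>' c] resc c(1) est[OF n order_refl] by blast
qed

text \<open>For \<open>\<epsilon> \<le> t\<close> the lower bound reads
  \<open>c * \<epsilon> \<le> g\<close>, so the PPS estimate in \<open>2 * \<epsilon> + g\<close>
  becomes one in \<open>g\<close> alone. All constants of the chain then go into the outermost
  residual function, leaving only \<open>1 + t\<close> outside.\<close>

lemma pps_chain_error_bound:
  fixes K M :: "'a::euclidean_space set"
  assumes K: "closed_convex_cone K" and M: "subspace M"
    and chain: "pps_chain K M b F z (Suc n)" and n: "1 \<le> n"
    and frf: "\<forall>i\<in>{1..n}. facial_residual_function K (F i) (z i) (\<psi> i)"
  shows "\<exists>\<psi>'. (\<forall>i\<in>{1..n}. positive_rescaling (\<psi> i) (\<psi>' i)) \<and>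
      (\<forall>\<epsilon>\<ge>0. \<forall>t\<ge>0. 0 \<le> diamonds \<psi>' n \<epsilon> t) \<and>
      (\<forall>x\<in>span K. \<forall>\<epsilon> t. infdist x K \<le> 2 * \<epsilon> \<and> infdist x ((+) b ` M) \<le> 2 * \<epsilon> \<and>
         norm x \<le> 2 * t \<and> \<epsilon> \<le> t \<longrightarrow>
         infdist x (K \<inter> (+) b ` M) \<le> (1 + t) * diamonds \<psi>' n \<epsilon> t)"
proof -
  have red: "reduction_sequence K M b F z n" and strict: "F (Suc n) \<subset> F n"
    and pps: "pps_condition (F (Suc n)) M b"
    using chain n by (auto simp: pps_chain_def)
  obtain \<psi>1 c where 1: "\<forall>i\<in>{1..n}. positive_rescaling (\<psi> i) (\<psi>1 i)"
    "0 < c" "\<And>\<epsilon> t. 0 \<le> \<epsilon> \<Longrightarrow> 0 \<le> t \<Longrightarrow> c * min \<epsilon> t \<le> diamonds \<psi>1 n \<epsilon> t"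
    "\<And>x \<epsilon> t. x \<in> span K \<Longrightarrow> infdist x K \<le> 2 * \<epsilon> \<Longrightarrow> infdist x ((+) b ` M) \<le> 2 * \<epsilon> \<Longrightarrow>
       norm x \<le> 2 * t \<Longrightarrow> infdist x (F (Suc n)) \<le> diamonds \<psi>1 n \<epsilon> t"
    using facial_residual_chain[OF K M red n strict frf] by blast
  obtain k where k: "k > 0" "\<And>x \<epsilon>. infdist x (F (Suc n)) \<le> \<epsilon> \<Longrightarrow> infdist x ((+) b ` M) \<le> \<epsilon> \<Longrightarrow>
            infdist x (F (Suc n) \<inter> (+) b ` M) \<le> k * (norm x + 1) * \<epsilon>"
    using pps_error_bound[OF pps M] by blast
  have FA: "F (Suc n) \<inter> (+) b ` M = K \<inter> (+) b ` M"
    using reduction_sequence_face[OF closed_convex_coneD(2)[OF K] red, of "Suc n"] by simp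
  \<comment> \<open>Here \<open>k\<close> is the PPS constant, \<open>2\<close> comes from
    \<open>norm x + 1 \<le> 2 * (1 + t)\<close>, and the last factor from
    \<open>2 * \<epsilon> + g \<le> (2 / c + 1) * g\<close>.\<close>
  define B where "B = 2 * k * (2 / c + 1)"
  have B: "B > 0" using k(1) 1(2) by (simp add: B_def add_pos_pos)
  obtain \<psi>' where 2: "\<forall>i\<in>{1..n}. positive_rescaling (\<psi> i) (\<psi>' i)"
    "\<And>s t. diamonds \<psi>' n s t = B * diamonds \<psi>1 n s t"
    using diamonds_rescale_last[OF n B 1(1)] by blast
  have nonneg: "0 \<le> diamonds \<psi>1 n \<epsilon> t" if "0 \<le> \<epsilon>" "0 \<le> t" for \<epsilon> t
  proof -
    have "0 \<le> c * min \<epsilon> t" using that 1(2) by simp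
    then show ?thesis using 1(3)[OF that] by linarith
  qed
  have "infdist x (K \<inter> (+) b ` M) \<le> (1 + t) * diamonds \<psi>' n \<epsilon> t"
    if x: "x \<in> span K" "infdist x K \<le> 2 * \<epsilon>" "infdist x ((+) b ` M) \<le> 2 * \<epsilon>"
      "norm x \<le> 2 * t" "\<epsilon> \<le> t" for x \<epsilon> t
  proof -
    define g where "g = diamonds \<psi>1 n \<epsilon> t"
    have e0: "0 \<le> \<epsilon>" using x(2) infdist_nonneg[of x K] by linarith
    have t0: "0 \<le> t" using x(5) e0 by linarith
    have g0: "0 \<le> g" unfolding g_def using nonneg e0 t0 by blast
    have "c * \<epsilon> \<le> g" unfolding g_def using 1(3)[OF e0 t0] x(5) by (simp add: min_def)
    then have eg: "2 * \<epsilon> + g \<le> (2 / c + 1) * g" using 1(2) by (simp add: field_simps)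
    have "infdist x (F (Suc n)) \<le> g" unfolding g_def using 1(4) x by blast
    then have "infdist x (K \<inter> (+) b ` M) \<le> k * (norm x + 1) * (2 * \<epsilon> + g)"
      unfolding FA[symmetric] using x(3) e0 g0 by (intro k(2)) auto
    also have "\<dots> \<le> k * (2 * (1 + t)) * ((2 / c + 1) * g)"
      using x(4) k(1) e0 g0 eg t0 by (intro mult_mono) auto
    also have "\<dots> = (1 + t) * diamonds \<psi>' n \<epsilon> t"
      unfolding 2(2) g_def[symmetric] B_def by (simp only: mult_ac)
    finally show ?thesis .
  qed
  moreover have "0 \<le> diamonds \<psi>' n \<epsilon> t" if "0 \<le> \<epsilon>" "0 \<le> t" for \<epsilon> t
    using nonneg[OF that] B by (simp add: 2(2))
  ultimately show ?thesis using 2(1) by blast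
qed

section \<open>Lengths of reduction sequences\<close>

lemma pps_condition_rel_interior:
  fixes C M :: "'a::euclidean_space set"
  assumes C: "closed_convex_cone C" and x: "x \<in> rel_interior C" "x \<in> (+) b ` M"
  shows "pps_condition C M b"
  unfolding pps_condition_def
proof (intro exI conjI)
  show "subspace (UNIV :: 'a set)" "subspace {0::'a}" by auto
  show "\<forall>u\<in>UNIV. \<forall>v\<in>{0::'a}. orthogonal u v" by (simp add: orthogonal_def)
  show "UNIV + {0::'a} = UNIV" "C = C + {0}" by (simp_all add: set_plus_def)
  show "\<exists>x1\<in>rel_interior C. \<exists>x2\<in>{0}. x1 + x2 \<in> (+) b ` M" using x by auto
qed (use C closed_convex_cone_singleton affine_imp_polyhedron[OF affine_sing] in auto)

text \<open>Take \<open>x\<close> relatively interior to the feasible set. If it lay on the relative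
  boundary of \<open>F\<close>, a supporting hyperplane would cut out a proper face \<open>G\<close>
  through \<open>x\<close>. A face meeting the relative interior of a convex subset contains that
  subset, so \<open>G\<close> would contain all feasible points, against minimality.\<close>

lemma minimal_face_rel_interior:
  fixes K A :: "'a::euclidean_space set"
  assumes K: "closed_convex_cone K" and A: "convex A" and ne: "K \<inter> A \<noteq> {}"
    and F: "minimal_face F K (K \<inter> A)"
  shows "rel_interior F \<inter> A \<noteq> {}"
proof
  assume disj: "rel_interior F \<inter> A = {}"
  note K' = closed_convex_coneD[OF K]
  have FK: "cone_face F K" "K \<inter> A \<subseteq> F" using F by (auto simp: minimal_face_def)
  note F' = closed_convex_coneD[OF cone_face_closed_convex_cone[OF K FK(1)]]
  have "convex (K \<inter> A)" using K'(3) A by (rule convex_Int)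
  then have "rel_interior (K \<inter> A) \<noteq> {}" using ne by (simp add: rel_interior_eq_empty)
  then obtain x where x: "x \<in> rel_interior (K \<inter> A)" by blast
  then have xF: "x \<in> F" "x \<in> A" using rel_interior_subset FK(2) by blast+
  then have xn: "x \<notin> rel_interior F" using disj by blast
  have "\<exists>a. (\<forall>y\<in>F. a \<bullet> x \<le> a \<bullet> y) \<and> (\<forall>y\<in>rel_interior F. a \<bullet> x < a \<bullet> y)"
    by (rule supporting_hyperplane_rel_boundary[OF F'(3) xF(1) xn]) metis
  then obtain a where a: "\<And>y. y \<in> F \<Longrightarrow> a \<bullet> x \<le> a \<bullet> y" "\<And>y. y \<in> rel_interior F \<Longrightarrow> a \<bullet> x < a \<bullet> y"
    by blast
  define G where "G = F \<inter> {y. a \<bullet> y = a \<bullet> x}"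
  have "G face_of F" unfolding G_def
    using F'(3) a(1) by (rule face_of_Int_supporting_hyperplane_ge)
  moreover have xG: "x \<in> G" using xF by (simp add: G_def)
  ultimately have "cone_face G F" using cone_face_iff_face_of[OF F'(2)] by blast
  then have GK: "cone_face G K" using FK(1) by (rule cone_face_trans)
  then have GfK: "G face_of K" using cone_face_iff_face_of[OF K'(2)] by blast
  have "G \<inter> rel_interior (K \<inter> A) \<noteq> {}" using xG x by blast
  from subset_of_face_of[OF GfK Int_lower1 this] have "K \<inter> A \<subseteq> G" .
  then have "F \<subseteq> G" using F GK by (simp add: minimal_face_def)
  moreover have "rel_interior F \<noteq> {}" using F'(3,5) by (simp add: rel_interior_eq_empty)
  then obtain r where "r \<in> rel_interior F" by blast
  ultimately show False using a(2)[of r] rel_interior_subset[of F] by (auto simp: G_def)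
qed

text \<open>Every face containing \<open>S\<close> meets the relative interior of \<open>F\<close>
  at \<open>x\<close> and therefore contains \<open>F\<close>.\<close>

lemma rel_interior_minimal_face:
  fixes K :: "'a::euclidean_space set"
  assumes K: "convex_cone K" and F: "cone_face F K" "S \<subseteq> F" and x: "x \<in> rel_interior F" "x \<in> S"
  shows "minimal_face F K S"
  unfolding minimal_face_def
proof (intro conjI allI impI F)
  fix G assume G: "cone_face G K \<and> S \<subseteq> G"
  then have "G face_of K" using cone_face_iff_face_of[OF K] by blast
  moreover have "F \<subseteq> K" using F(1) by (rule cone_face_subset)
  moreover have "G \<inter> rel_interior F \<noteq> {}" using G x by blast
  ultimately show "F \<subseteq> G" by (rule subset_of_face_of)
qed

section \<open>Existence and minimality of reduction sequences\<close>

lemma reduction_sequence_0: "reduction_sequence K M b (\<lambda>_. K) z 0"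
  by (simp add: reduction_sequence_def)

text \<open>Inductions on the cone recurse into the smaller face, so the step just made has to be
  put in front of the sequence obtained there.\<close>

lemma reduction_sequence_Cons:
  assumes z: "z \<in> dual_cone K \<inter> M\<^sup>\<bottom> \<inter> {b}\<^sup>\<bottom>" and red: "reduction_sequence (K \<inter> {z}\<^sup>\<bottom>) M b F zs k"
  obtains F' zs' where "reduction_sequence K M b F' zs' (Suc k)" "F' (Suc (Suc k)) = F (Suc k)"
proof
  let ?F = "\<lambda>i. if i \<le> 1 then K else F (i - 1)" and ?z = "\<lambda>i. if i \<le> 1 then z else zs (i - 1)"
  show "reduction_sequence K M b ?F ?z (Suc k)"
    unfolding reduction_sequence_def
  proof (intro conjI ballI)
    fix i assume i: "i \<in> {1..Suc k}"
    then consider "i = 1" | j where "i = Suc j" "j \<in> {1..k}" by (cases i) fastforce+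
    then have "?z i \<in> dual_cone (?F i) \<inter> M\<^sup>\<bottom> \<inter> {b}\<^sup>\<bottom> \<and> ?F (Suc i) = ?F i \<inter> {?z i}\<^sup>\<bottom>"
      by cases (use z red in \<open>auto simp: reduction_sequence_def\<close>)
    then show "?z i \<in> dual_cone (?F i) \<inter> M\<^sup>\<bottom> \<inter> {b}\<^sup>\<bottom>" "?F (Suc i) = ?F i \<inter> {?z i}\<^sup>\<bottom>" by blast+
  qed simp
qed simp

lemma exposed_face_dim_less:
  fixes K :: "'a::euclidean_space set"
  assumes "x \<in> K" "z \<bullet> x \<noteq> 0"
  shows "dim (K \<inter> {z}\<^sup>\<bottom>) < dim K"
proof (rule dim_psubset)
  have "span (K \<inter> {z}\<^sup>\<bottom>) \<subseteq> {x. z \<bullet> x = 0}"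
    by (intro span_minimal subspace_hyperplane) (auto simp: mem_orthogonal_comp_singleton)
  then have "x \<notin> span (K \<inter> {z}\<^sup>\<bottom>)" using assms(2) by auto
  moreover have "span (K \<inter> {z}\<^sup>\<bottom>) \<subseteq> span K" by (intro span_mono) auto
  ultimately show "span (K \<inter> {z}\<^sup>\<bottom>) \<subset> span K" using assms(1) span_base by blast
qed

lemma feasible_exposed_face:
  assumes "z \<in> M\<^sup>\<bottom> \<inter> {b}\<^sup>\<bottom>"
  shows "K \<inter> {z}\<^sup>\<bottom> \<inter> (+) b ` M = K \<inter> (+) b ` M"
  using reduction_direction_vanishes[OF assms] by (auto simp: mem_orthogonal_comp_singleton)

text \<open>With \<open>{0}\<close> as polyhedral summand the reduction step gives a functional that
  is nonzero on \<open>K\<close> as long as Slater's condition fails, so the dimension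
  drops.\<close>

lemma facial_reduction:
  fixes K M :: "'a::euclidean_space set"
  assumes "closed_convex_cone K" and M: "subspace M" and "K \<inter> (+) b ` M \<noteq> {}"
  shows "\<exists>F z k. reduction_sequence K M b F z k \<and> rel_interior (F (Suc k)) \<inter> (+) b ` M \<noteq> {}"
  using assms(1,3)
proof (induction "dim K" arbitrary: K rule: less_induct)
  case less
  note K = closed_convex_coneD[OF less.prems(1)]
  show ?case
  proof (cases "rel_interior K \<inter> (+) b ` M = {}")
    case False
    then show ?thesis using reduction_sequence_0 by blast
  next
    case True
    then have disj: "(rel_interior K + {0}) \<inter> (+) b ` M = {}" by (simp add: set_plus_def)
    have K0: "K + {0} = K" by (simp add: set_plus_def)
    then have feas: "(K + {0}) \<inter> (+) b ` M \<noteq> {}" using less.prems(2) by simp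
    from facial_reduction_step[OF K(2) convex_cone_singleton affine_imp_polyhedron[OF affine_sing] M feas disj]
    obtain z x where z: "z \<in> dual_cone K \<inter> M\<^sup>\<bottom> \<inter> {b}\<^sup>\<bottom>" "x \<in> K" "z \<bullet> x \<noteq> 0" unfolding K0 by blast
    have face: "cone_face (K \<inter> {z}\<^sup>\<bottom>) K" using z(1) K(2) by (intro cone_face_exposed) auto
    have "K \<inter> {z}\<^sup>\<bottom> \<inter> (+) b ` M \<noteq> {}" using feasible_exposed_face[of z M b K] z(1) less.prems(2) by auto
    from less.hyps[OF exposed_face_dim_less[OF z(2,3)] cone_face_closed_convex_cone[OF less.prems(1) face] this]
    obtain F zs k where red: "reduction_sequence (K \<inter> {z}\<^sup>\<bottom>) M b F zs k"
      and "rel_interior (F (Suc k)) \<inter> (+) b ` M \<noteq> {}" by blast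
    moreover from reduction_sequence_Cons[OF z(1) red] obtain F' zs'
      where "reduction_sequence K M b F' zs' (Suc k)" "F' (Suc (Suc k)) = F (Suc k)" .
    ultimately show ?thesis by metis
  qed
qed

text \<open>Both numbers are \<open>LEAST\<close> values, so attainment comes first: facial
  reduction ends at a face with a feasible relative interior point, which is minimal. Conversely a
  minimal face has such a point and satisfies the PPS condition with a trivial polyhedral
  factor.\<close>

lemma d_PPS_le_singularity_degree:
  fixes K M :: "'a::euclidean_space set"
  assumes K: "closed_convex_cone K" and M: "subspace M" and feas: "K \<inter> (+) b ` M \<noteq> {}"
  shows "\<exists>F z. reduction_sequence K M b F z (d_PPS K M b) \<and> pps_condition (F (Suc (d_PPS K M b))) M b"
    and "d_PPS K M b \<le> singularity_degree K M b"
proof -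
  note K' = closed_convex_coneD[OF K]
  let ?S = "\<lambda>k. \<exists>F z. reduction_sequence K M b F z k \<and> minimal_face (F (Suc k)) K (K \<inter> (+) b ` M)"
  let ?P = "\<lambda>k. \<exists>F z. reduction_sequence K M b F z k \<and> pps_condition (F (Suc k)) M b"
  obtain F z k where red: "reduction_sequence K M b F z k" and ri: "rel_interior (F (Suc k)) \<inter> (+) b ` M \<noteq> {}"
    using facial_reduction[OF K M feas] by blast
  have F: "cone_face (F (Suc k)) K" "F (Suc k) \<inter> (+) b ` M = K \<inter> (+) b ` M"
    using reduction_sequence_face[OF K'(2) red, of "Suc k"] by auto
  obtain x where x: "x \<in> rel_interior (F (Suc k))" "x \<in> (+) b ` M" using ri by blast
  have "minimal_face (F (Suc k)) K (K \<inter> (+) b ` M)"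
    using K'(2) F(1) _ x(1)
  proof (rule rel_interior_minimal_face)
    show "K \<inter> (+) b ` M \<subseteq> F (Suc k)" "x \<in> K \<inter> (+) b ` M"
      using F(2) x rel_interior_subset by blast+
  qed
  then have "?S k" using red by blast
  then have "?S (singularity_degree K M b)" unfolding singularity_degree_def by (rule LeastI)
  then obtain F z where red: "reduction_sequence K M b F z (singularity_degree K M b)"
    and mf: "minimal_face (F (Suc (singularity_degree K M b))) K (K \<inter> (+) b ` M)" by blast
  have "convex ((+) b ` M)" using M by (simp add: subspace_imp_convex convex_translation)
  from minimal_face_rel_interior[OF K this feas mf] obtain x
    where "x \<in> rel_interior (F (Suc (singularity_degree K M b)))" "x \<in> (+) b ` M" by blast
  moreover have "closed_convex_cone (F (Suc (singularity_degree K M b)))"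
    using mf cone_face_closed_convex_cone[OF K] by (simp add: minimal_face_def)
  ultimately have P: "?P (singularity_degree K M b)" using red pps_condition_rel_interior by blast
  show "?P (d_PPS K M b)" unfolding d_PPS_def using P by (rule LeastI)
  show "d_PPS K M b \<le> singularity_degree K M b" unfolding d_PPS_def using P by (rule Least_le)
qed

text \<open>The functional \<open>z i\<close> is removed together with the duplicate
  \<open>F (Suc i)\<close>, hence the different cut-offs. At position \<open>i\<close> the
  functional \<open>z (Suc i)\<close> fits because it lies in the dual of
  \<open>F (Suc i) = F i\<close>.\<close>

lemma reduction_sequence_drop:
  assumes red: "reduction_sequence K M b F z (Suc k)" and i: "1 \<le> i" "i \<le> Suc k" and eq: "F (Suc i) = F i"
  shows "reduction_sequence K M b (\<lambda>j. if j \<le> i then F j else F (Suc j))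
           (\<lambda>j. if j < i then z j else z (Suc j)) k"
  unfolding reduction_sequence_def
proof (intro conjI ballI)
  let ?F = "\<lambda>j. if j \<le> i then F j else F (Suc j)" and ?z = "\<lambda>j. if j < i then z j else z (Suc j)"
  show "?F 1 = K" using red i by (simp add: reduction_sequence_def)
  fix j assume j: "j \<in> {1..k}"
  have *: "z j \<in> dual_cone (F j) \<inter> M\<^sup>\<bottom> \<inter> {b}\<^sup>\<bottom>" "F (Suc j) = F j \<inter> {z j}\<^sup>\<bottom>" if "j \<in> {1..Suc k}" for j
    using red that unfolding reduction_sequence_def by blast+
  consider "j < i" | "j = i" | "j > i" by linarith
  then have "?z j \<in> dual_cone (?F j) \<inter> M\<^sup>\<bottom> \<inter> {b}\<^sup>\<bottom> \<and> ?F (Suc j) = ?F j \<inter> {?z j}\<^sup>\<bottom>"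
  proof cases
    case 1
    then show ?thesis using *[of j] j by auto
  next
    case 2
    then show ?thesis using *[of "Suc j"] j eq by auto
  next
    case 3
    then show ?thesis using *[of "Suc j"] j by auto
  qed
  then show "?z j \<in> dual_cone (?F j) \<inter> M\<^sup>\<bottom> \<inter> {b}\<^sup>\<bottom>" "?F (Suc j) = ?F j \<inter> {?z j}\<^sup>\<bottom>" by blast+
qed

text \<open>Dropping a repeated face would give a sequence shorter than the minimum.\<close>

lemma d_PPS_sequence_strict:
  assumes red: "reduction_sequence K M b F z (d_PPS K M b)"
    and pps: "pps_condition (F (Suc (d_PPS K M b))) M b" and i: "1 \<le> i" "i \<le> d_PPS K M b"
  shows "F (Suc i) \<subset> F i"
proof (rule ccontr)
  assume "\<not> F (Suc i) \<subset> F i"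
  moreover have "F (Suc i) \<subseteq> F i" using red i by (auto simp: reduction_sequence_def)
  ultimately have eq: "F (Suc i) = F i" by blast
  obtain k where k: "d_PPS K M b = Suc k" using i by (cases "d_PPS K M b") auto
  have "reduction_sequence K M b (\<lambda>j. if j \<le> i then F j else F (Suc j)) (\<lambda>j. if j < i then z j else z (Suc j)) k"
    using reduction_sequence_drop[of K M b F z k i] red i eq k by simp
  moreover have "pps_condition (if Suc k \<le> i then F (Suc k) else F (Suc (Suc k))) M b"
  proof (cases "Suc k \<le> i")
    case True
    then have "i = Suc k" using i k by simp
    then show ?thesis using pps eq k by simp
  qed (use pps k in simp)
  ultimately have "d_PPS K M b \<le> k" unfolding d_PPS_def by (intro Least_le) blast
  then show False using k by simp
qed

text \<open>The functionals are linearly independent: all earlier ones vanish on the current face,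
  so a combination of them would cut nothing off.\<close>

lemma strict_reduction_length_le_dim:
  fixes M :: "'a::euclidean_space set"
  assumes red: "reduction_sequence K M b F z k" and strict: "\<And>i. 1 \<le> i \<Longrightarrow> i \<le> k \<Longrightarrow> F (Suc i) \<noteq> F i"
  shows "k \<le> dim (M\<^sup>\<bottom> \<inter> {b}\<^sup>\<bottom>)"
proof -
  have zF: "z i \<in> M\<^sup>\<bottom> \<inter> {b}\<^sup>\<bottom>" "F (Suc i) = F i \<inter> {z i}\<^sup>\<bottom>" if "1 \<le> i" "i \<le> k" for i
    using red that by (auto simp: reduction_sequence_def)
  have "dim (z ` {1..j}) = j \<and> (\<forall>i\<in>{1..j}. \<forall>x\<in>F (Suc j). z i \<bullet> x = 0)" if "j \<le> k" for j
    using that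
  proof (induction j)
    case 0
    then show ?case by simp
  next
    case (Suc j)
    then have IH: "dim (z ` {1..j}) = j" "\<forall>i\<in>{1..j}. \<forall>x\<in>F (Suc j). z i \<bullet> x = 0" by auto
    have F: "F (Suc (Suc j)) = F (Suc j) \<inter> {z (Suc j)}\<^sup>\<bottom>" using zF(2)[of "Suc j"] Suc.prems by simp
    have "z (Suc j) \<notin> span (z ` {1..j})"
    proof
      assume sp: "z (Suc j) \<in> span (z ` {1..j})"
      have "z (Suc j) \<bullet> x = 0" if "x \<in> F (Suc j)" for x
      proof -
        have "span (z ` {1..j}) \<subseteq> {y. x \<bullet> y = 0}"
          using IH(2) that by (intro span_minimal subspace_hyperplane) (auto simp: inner_commute)
        then show ?thesis using sp by (auto simp: inner_commute)
      qed
      then have "F (Suc (Suc j)) = F (Suc j)" unfolding F by (auto simp: mem_orthogonal_comp_singleton)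
      then show False using strict[of "Suc j"] Suc.prems by simp
    qed
    then have "dim (z ` {1..Suc j}) = Suc j"
      using IH(1) by (simp add: atLeastAtMostSuc_conv dim_insert)
    moreover have "z i \<bullet> x = 0" if "i \<in> {1..Suc j}" "x \<in> F (Suc (Suc j))" for i x
      using IH(2) that unfolding F by (cases "i = Suc j") (auto simp: mem_orthogonal_comp_singleton)
    ultimately show ?case by blast
  qed
  then have "dim (z ` {1..k}) = k" by simp
  moreover have "z ` {1..k} \<subseteq> M\<^sup>\<bottom> \<inter> {b}\<^sup>\<bottom>" using zF(1) by auto
  ultimately show ?thesis using dim_subset by metis
qed

section \<open>Distance to polyhedrality\<close>

lemma pointed_cone_face:
  assumes "pointed C" "cone_face F C"
  shows "pointed F"
proof -
  have "0 \<in> F" "F \<subseteq> C" using assms(2) convex_cone_contains_0 by (auto simp: cone_face_def)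
  then show ?thesis using assms(1) unfolding pointed_def by force
qed

text \<open>Proper faces lose affine dimension and the last one is nonempty. The bound makes
  \<open>GREATEST\<close> in the distance to polyhedrality meaningful.\<close>

lemma polyhedrality_chain_length:
  fixes C :: "'a::euclidean_space set"
  assumes C: "closed_convex_cone C" and chain: "polyhedrality_chain C G m"
  shows "m \<le> DIM('a) + 1"
proof -
  have m: "1 \<le> m" and face: "\<And>j. 1 \<le> j \<Longrightarrow> j \<le> m \<Longrightarrow> cone_face (G j) C"
    and strict: "\<And>j. 1 \<le> j \<Longrightarrow> j < m \<Longrightarrow> G (Suc j) \<subset> G j"
    using chain by (auto simp: polyhedrality_chain_def)
  note C' = closed_convex_coneD[OF C]
  have ff: "G j face_of C" "G j \<noteq> {}" if "1 \<le> j" "j \<le> m" for j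
    using face[OF that] cone_face_iff_face_of[OF C'(2)] by auto
  have "aff_dim (G j) + int j \<le> int DIM('a) + 1" if "1 \<le> j" "j \<le> m" for j
    using that
  proof (induction j rule: dec_induct)
    case base
    then show ?case using aff_dim_le_DIM[of "G 1"] by simp
  next
    case (step j)
    then have j: "1 \<le> j" "j < m" "j \<le> m" "1 \<le> Suc j" "Suc j \<le> m" by auto
    have "G (Suc j) face_of G j"
      using face_of_subset[OF ff(1)[OF j(4,5)] _ face_of_imp_subset[OF ff(1)[OF j(1,3)]]] strict[OF j(1,2)]
      by blast
    moreover have "convex (G j)" using ff(1)[OF j(1,3)] by (rule face_of_imp_convex)
    moreover have "G (Suc j) \<noteq> G j" using strict[OF j(1,2)] by blast
    ultimately have "aff_dim (G (Suc j)) < aff_dim (G j)" using face_of_aff_dim_lt by blast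
    then show ?case using step.IH j(3) by simp
  qed
  from this[of m] m have "aff_dim (G m) + int m \<le> int DIM('a) + 1" by simp
  moreover have "0 \<le> aff_dim (G m)" using ff(2)[OF m order_refl] aff_dim_negative_iff[of "G m"] by linarith
  ultimately show ?thesis by simp
qed

lemma cone_face_zero:
  assumes C: "convex_cone C" and p: "pointed C"
  shows "cone_face {0} C"
proof -
  have "x = 0 \<and> y = 0" if xy: "x \<in> C" "y \<in> C" "x + y = 0" for x y
  proof -
    have "x = - y" using xy(3) by (simp add: eq_neg_iff_add_eq_0)
    then have "x \<in> C \<inter> uminus ` C" using xy(1,2) by (intro IntI image_eqI[of _ _ y])
    then have "x = 0" using p unfolding pointed_def by blast
    then show ?thesis using xy(3) by simp
  qed
  then show ?thesis using convex_cone_contains_0[OF C] by (auto simp: cone_face_def)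
qed

text \<open>By pointedness \<open>{0}\<close> is a polyhedral face and thus a chain of length
  \<open>1\<close>, so the maximal length exists and the subtraction in the definition is not
  truncated.\<close>

lemma distance_to_polyhedrality_greatest:
  fixes C :: "'a::euclidean_space set"
  assumes C: "closed_convex_cone C" and p: "pointed C"
  shows "\<exists>G. polyhedrality_chain C G (Suc (distance_to_polyhedrality C))"
    and "polyhedrality_chain C G m \<Longrightarrow> m \<le> Suc (distance_to_polyhedrality C)"
proof -
  let ?P = "\<lambda>m. \<exists>G. polyhedrality_chain C G m"
  have "polyhedrality_chain C (\<lambda>_. {0}) 1"
    using cone_face_zero[OF closed_convex_coneD(2)[OF C] p] affine_imp_polyhedron[OF affine_sing]
    by (simp add: polyhedrality_chain_def)
  then have 1: "?P 1" by blast
  have bd: "m \<le> DIM('a) + 1" if "?P m" for m using polyhedrality_chain_length[OF C] that by blast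
  have G: "?P (GREATEST m. ?P m)" by (rule GreatestI_nat[of ?P, OF 1 bd])
  then have "1 \<le> (GREATEST m. ?P m)" by (auto simp: polyhedrality_chain_def)
  then have eq: "Suc (distance_to_polyhedrality C) = (GREATEST m. ?P m)"
    by (simp add: distance_to_polyhedrality_def)
  show "?P (Suc (distance_to_polyhedrality C))" unfolding eq by (rule G)
  show "m \<le> Suc (distance_to_polyhedrality C)" if "polyhedrality_chain C G m"
  proof -
    have "?P m" using that by blast
    then show ?thesis unfolding eq by (rule Greatest_le_nat[of ?P, OF _ bd])
  qed
qed

text \<open>Chains need not start at the whole cone, so a chain in \<open>F\<close> is one in
  \<open>C\<close>.\<close>

lemma distance_to_polyhedrality_mono:
  assumes C: "closed_convex_cone C" and p: "pointed C" and F: "cone_face F C"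
  shows "distance_to_polyhedrality F \<le> distance_to_polyhedrality C"
proof -
  obtain G where "polyhedrality_chain F G (Suc (distance_to_polyhedrality F))"
    using distance_to_polyhedrality_greatest(1)[OF cone_face_closed_convex_cone[OF C F] pointed_cone_face[OF p F]]
    by blast
  then have "polyhedrality_chain C G (Suc (distance_to_polyhedrality F))"
    using cone_face_trans[OF _ F] by (auto simp: polyhedrality_chain_def)
  then show ?thesis using distance_to_polyhedrality_greatest(2)[OF C p] by force
qed

text \<open>A longest chain of \<open>F\<close> can be prolonged by \<open>C\<close> at the top,
  where a nonpolyhedral member is required.\<close>

lemma distance_to_polyhedrality_strict:
  assumes C: "closed_convex_cone C" and p: "pointed C" and F: "cone_face F C" "F \<noteq> C"
    and np: "\<not> polyhedron C"
  shows "distance_to_polyhedrality F < distance_to_polyhedrality C"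
proof -
  let ?m = "Suc (distance_to_polyhedrality F)"
  obtain G where G: "polyhedrality_chain F G ?m"
    using distance_to_polyhedrality_greatest(1)[OF cone_face_closed_convex_cone[OF C F(1)] pointed_cone_face[OF p F(1)]]
    by blast
  define G' where "G' j = (if j \<le> 1 then C else G (j - 1))" for j :: nat
  have face: "cone_face (G j) C" "G j \<subseteq> F" if "j \<in> {1..?m}" for j
  proof -
    have "cone_face (G j) F" using G that unfolding polyhedrality_chain_def by blast
    then show "cone_face (G j) C" "G j \<subseteq> F" using cone_face_trans[OF _ F(1)] cone_face_subset by blast+
  qed
  have "F \<subset> C" using F cone_face_subset by blast
  then have G1: "G 1 \<subset> C" using face(2)[of 1] by auto
  have "polyhedrality_chain C G' (Suc ?m)"
    unfolding polyhedrality_chain_def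
  proof (intro conjI ballI)
    fix j assume j: "j \<in> {1..Suc ?m}"
    then consider "j = 1" | i where "j = Suc i" "i \<in> {1..?m}" by (cases j) fastforce+
    then show "cone_face (G' j) C"
      by cases (use face cone_face_refl[OF closed_convex_coneD(2)[OF C]] in \<open>auto simp: G'_def\<close>)
  next
    fix j assume j: "j \<in> {1..<Suc ?m}"
    then consider "j = 1" | i where "j = Suc i" "i \<in> {1..<?m}" by (cases j) fastforce+
    then have "G' (Suc j) \<subset> G' j \<and> \<not> polyhedron (G' j)"
      by cases (use G1 np G in \<open>auto simp: G'_def polyhedrality_chain_def\<close>)
    then show "G' (Suc j) \<subset> G' j" "\<not> polyhedron (G' j)" by auto
  next
    show "polyhedron (G' (Suc ?m))" using G by (simp add: G'_def polyhedrality_chain_def)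
  qed simp
  from distance_to_polyhedrality_greatest(2)[OF C p this] show ?thesis by simp
qed

section \<open>Reduction of a product of two cones\<close>

lemma set_plus_Times: "A \<times> B + C \<times> D = (A + C) \<times> (B + D)"
  by (auto simp: set_plus_def)

text \<open>All of \<open>C\<close> goes into \<open>B\<close> if it is polyhedral and into
  \<open>A\<close> otherwise. The last clause converts a functional nonzero on \<open>A\<close> into
  one nonzero on a nonpolyhedral \<open>C\<close>.\<close>

lemma polyhedral_split:
  fixes C :: "'a::euclidean_space set"
  assumes C: "closed_convex_cone C"
  shows "\<exists>U W A B. subspace U \<and> subspace W \<and> (\<forall>u\<in>U. \<forall>w\<in>W. orthogonal u w) \<and> U + W = UNIV \<and>
     closed_convex_cone A \<and> A \<subseteq> U \<and> closed_convex_cone B \<and> B \<subseteq> W \<and> polyhedron B \<and> C = A + B \<and>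
     (A \<noteq> {0} \<longrightarrow> A = C \<and> \<not> polyhedron C)"
proof (cases "polyhedron C")
  case True
  show ?thesis
    by (rule exI[of _ "{0}"], rule exI[of _ UNIV], rule exI[of _ "{0}"], rule exI[of _ C])
       (use True C closed_convex_cone_singleton in \<open>auto simp: orthogonal_def set_plus_def\<close>)
next
  case False
  show ?thesis
    by (rule exI[of _ UNIV], rule exI[of _ "{0}"], rule exI[of _ C], rule exI[of _ "{0}"])
       (use False C closed_convex_cone_singleton affine_imp_polyhedron[OF affine_sing] in
         \<open>auto simp: orthogonal_def set_plus_def\<close>)
qed

text \<open>The PPS condition fails for every split, in particular for the one that puts the
  nonpolyhedral factors into \<open>?A\<close> and the polyhedral ones into
  \<open>?B\<close>.\<close>

lemma pps_reduction_step_Times: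
  fixes C1 :: "'a::euclidean_space set" and C2 :: "'b::euclidean_space set"
  assumes C: "closed_convex_cone C1" "closed_convex_cone C2" and M: "subspace M"
    and feas: "C1 \<times> C2 \<inter> (+) b ` M \<noteq> {}" and npps: "\<not> pps_condition (C1 \<times> C2) M b"
  shows "\<exists>z1 z2. (z1, z2) \<in> dual_cone (C1 \<times> C2) \<inter> M\<^sup>\<bottom> \<inter> {b}\<^sup>\<bottom> \<and>
     ((\<not> polyhedron C1 \<and> (\<exists>x\<in>C1. z1 \<bullet> x \<noteq> 0)) \<or> (\<not> polyhedron C2 \<and> (\<exists>x\<in>C2. z2 \<bullet> x \<noteq> 0)))"
proof -
  obtain U1 W1 A1 B1 where 1: "subspace U1" "subspace W1" "\<forall>u\<in>U1. \<forall>w\<in>W1. orthogonal u w" "U1 + W1 = UNIV"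
     "closed_convex_cone A1" "A1 \<subseteq> U1" "closed_convex_cone B1" "B1 \<subseteq> W1" "polyhedron B1" "C1 = A1 + B1"
     "A1 \<noteq> {0} \<longrightarrow> A1 = C1 \<and> \<not> polyhedron C1"
    using polyhedral_split[OF C(1)] by blast
  obtain U2 W2 A2 B2 where 2: "subspace U2" "subspace W2" "\<forall>u\<in>U2. \<forall>w\<in>W2. orthogonal u w" "U2 + W2 = UNIV"
     "closed_convex_cone A2" "A2 \<subseteq> U2" "closed_convex_cone B2" "B2 \<subseteq> W2" "polyhedron B2" "C2 = A2 + B2"
     "A2 \<noteq> {0} \<longrightarrow> A2 = C2 \<and> \<not> polyhedron C2"
    using polyhedral_split[OF C(2)] by blast
  let ?A = "A1 \<times> A2" and ?B = "B1 \<times> B2"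
  have CAB: "C1 \<times> C2 = ?A + ?B" using 1(10) 2(10) by (simp add: set_plus_Times)
  have A: "closed_convex_cone ?A" and B: "closed_convex_cone ?B" "polyhedron ?B"
    using 1 2 by (auto intro: closed_convex_cone_Times polyhedron_Times)
  have "(rel_interior ?A + ?B) \<inter> (+) b ` M = {}"
  proof (rule ccontr)
    assume "(rel_interior ?A + ?B) \<inter> (+) b ` M \<noteq> {}"
    then have "\<exists>x1\<in>rel_interior ?A. \<exists>x2\<in>?B. x1 + x2 \<in> (+) b ` M"
      by (metis disjoint_iff set_plus_elim)
    moreover have "subspace (U1 \<times> U2)" "subspace (W1 \<times> W2)" using 1 2 by (auto intro: subspace_Times)
    moreover have "\<forall>u\<in>U1 \<times> U2. \<forall>w\<in>W1 \<times> W2. orthogonal u w"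
      using 1(3) 2(3) by (auto simp: orthogonal_def inner_prod_def)
    moreover have "U1 \<times> U2 + W1 \<times> W2 = UNIV" using 1(4) 2(4) by (simp add: set_plus_Times)
    moreover have "?A \<subseteq> U1 \<times> U2" "?B \<subseteq> W1 \<times> W2" using 1 2 by auto
    ultimately have "pps_condition (C1 \<times> C2) M b"
      unfolding pps_condition_def using A B CAB
      by (intro exI[of _ "U1 \<times> U2"] exI[of _ "W1 \<times> W2"] exI[of _ ?A] exI[of _ ?B] conjI)
    then show False using npps by blast
  qed
  from facial_reduction_step[OF closed_convex_coneD(2)[OF A] closed_convex_coneD(2)[OF B(1)] B(2) M _ this]
  obtain z x where z: "z \<in> dual_cone (C1 \<times> C2) \<inter> M\<^sup>\<bottom> \<inter> {b}\<^sup>\<bottom>" and x: "x \<in> ?A" "z \<bullet> x \<noteq> 0"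
    using feas unfolding CAB by blast
  obtain z1 z2 x1 x2 where zx: "z = (z1, z2)" "x = (x1, x2)" by (cases z, cases x)
  have x12: "x1 \<in> A1" "x2 \<in> A2" using x(1) zx by auto
  have "z1 \<bullet> x1 \<noteq> 0 \<or> z2 \<bullet> x2 \<noteq> 0" using x(2) zx by auto
  then have "(\<not> polyhedron C1 \<and> (\<exists>x\<in>C1. z1 \<bullet> x \<noteq> 0)) \<or> (\<not> polyhedron C2 \<and> (\<exists>x\<in>C2. z2 \<bullet> x \<noteq> 0))"
  proof
    assume *: "z1 \<bullet> x1 \<noteq> 0"
    then have "A1 \<noteq> {0}" using x12 by auto
    then show ?thesis using 1(11) x12 * by blast
  next
    assume *: "z2 \<bullet> x2 \<noteq> 0"
    then have "A2 \<noteq> {0}" using x12 by auto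
    then show ?thesis using 2(11) x12 * by blast
  qed
  then show ?thesis using z zx(1) by blast
qed

text \<open>Since \<open>0\<close> lies in either factor, both summands of the inner product are
  nonnegative, and their sum vanishes only if both do.\<close>

lemma exposed_face_Times:
  assumes z: "(z1, z2) \<in> dual_cone (C1 \<times> C2)" and "0 \<in> C1" "0 \<in> C2"
  shows "z1 \<in> dual_cone C1" "z2 \<in> dual_cone C2"
    "C1 \<times> C2 \<inter> {(z1, z2)}\<^sup>\<bottom> = (C1 \<inter> {z1}\<^sup>\<bottom>) \<times> (C2 \<inter> {z2}\<^sup>\<bottom>)"
proof -
  have *: "0 \<le> z1 \<bullet> x + z2 \<bullet> y" if "x \<in> C1" "y \<in> C2" for x y
    using z that by (auto simp: dual_cone_def)
  have pos: "0 \<le> z1 \<bullet> x" if "x \<in> C1" for x using *[OF that assms(3)] by simp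
  have pos': "0 \<le> z2 \<bullet> y" if "y \<in> C2" for y using *[OF assms(2) that] by simp
  show "z1 \<in> dual_cone C1" "z2 \<in> dual_cone C2" using pos pos' by (auto simp: dual_cone_def)
  have "z1 \<bullet> x + z2 \<bullet> y = 0 \<longleftrightarrow> z1 \<bullet> x = 0 \<and> z2 \<bullet> y = 0" if "x \<in> C1" "y \<in> C2" for x y
    using pos[OF that(1)] pos'[OF that(2)] by linarith
  then show "C1 \<times> C2 \<inter> {(z1, z2)}\<^sup>\<bottom> = (C1 \<inter> {z1}\<^sup>\<bottom>) \<times> (C2 \<inter> {z2}\<^sup>\<bottom>)"
    by (auto simp: mem_orthogonal_comp_singleton)
qed

text \<open>One step may shrink both factors: one distance drops strictly and monotonicity keeps the
  other from growing. At sum \<open>0\<close> no drop is possible, so the PPS condition must hold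
  there.\<close>

lemma d_PPS_le_distance_to_polyhedrality:
  fixes C1 :: "'a::euclidean_space set" and C2 :: "'b::euclidean_space set"
  assumes "closed_convex_cone C1" "pointed C1" "closed_convex_cone C2" "pointed C2"
    and M: "subspace M" and "C1 \<times> C2 \<inter> (+) b ` M \<noteq> {}"
  shows "d_PPS (C1 \<times> C2) M b \<le> distance_to_polyhedrality C1 + distance_to_polyhedrality C2"
proof -
  have "\<exists>F z k. k \<le> distance_to_polyhedrality C1 + distance_to_polyhedrality C2 \<and>
      reduction_sequence (C1 \<times> C2) M b F z k \<and> pps_condition (F (Suc k)) M b"
    using assms(1-4,6)
  proof (induction "distance_to_polyhedrality C1 + distance_to_polyhedrality C2" arbitrary: C1 C2 rule: less_induct)
    case less
    note C1 = less.prems(1) and C2 = less.prems(3)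
    show ?case
    proof (cases "pps_condition (C1 \<times> C2) M b")
      case True
      then show ?thesis using reduction_sequence_0[of "C1 \<times> C2" M b]
        by (intro exI[of _ "\<lambda>_. C1 \<times> C2"] exI[of _ "\<lambda>_. 0"] exI[of _ 0]) simp
    next
      case False
      from pps_reduction_step_Times[OF C1 C2 M less.prems(5) False]
      obtain z1 z2 where z: "(z1, z2) \<in> dual_cone (C1 \<times> C2) \<inter> M\<^sup>\<bottom> \<inter> {b}\<^sup>\<bottom>"
        and nz: "(\<not> polyhedron C1 \<and> (\<exists>x\<in>C1. z1 \<bullet> x \<noteq> 0)) \<or> (\<not> polyhedron C2 \<and> (\<exists>x\<in>C2. z2 \<bullet> x \<noteq> 0))"
        by blast
      define D1 where "D1 = C1 \<inter> {z1}\<^sup>\<bottom>"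
      define D2 where "D2 = C2 \<inter> {z2}\<^sup>\<bottom>"
      have zd: "(z1, z2) \<in> dual_cone (C1 \<times> C2)" using z by blast
      note ex = exposed_face_Times[OF zd closed_convex_coneD(4)[OF C1] closed_convex_coneD(4)[OF C2]]
      have D: "C1 \<times> C2 \<inter> {(z1, z2)}\<^sup>\<bottom> = D1 \<times> D2" unfolding D1_def D2_def by (rule ex(3))
      have f1: "cone_face D1 C1" unfolding D1_def
        using closed_convex_coneD(2)[OF C1] ex(1) by (rule cone_face_exposed)
      have f2: "cone_face D2 C2" unfolding D2_def
        using closed_convex_coneD(2)[OF C2] ex(2) by (rule cone_face_exposed)
      have le: "distance_to_polyhedrality D1 \<le> distance_to_polyhedrality C1"
         "distance_to_polyhedrality D2 \<le> distance_to_polyhedrality C2"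
        using distance_to_polyhedrality_mono less.prems f1 f2 by blast+
      have lt: "distance_to_polyhedrality D1 + distance_to_polyhedrality D2
          < distance_to_polyhedrality C1 + distance_to_polyhedrality C2"
        using nz
      proof
        assume *: "\<not> polyhedron C1 \<and> (\<exists>x\<in>C1. z1 \<bullet> x \<noteq> 0)"
        then have "D1 \<noteq> C1" by (auto simp: D1_def mem_orthogonal_comp_singleton)
        then show ?thesis using distance_to_polyhedrality_strict[OF C1 less.prems(2) f1] * le(2) by force
      next
        assume *: "\<not> polyhedron C2 \<and> (\<exists>x\<in>C2. z2 \<bullet> x \<noteq> 0)"
        then have "D2 \<noteq> C2" by (auto simp: D2_def mem_orthogonal_comp_singleton)
        then show ?thesis using distance_to_polyhedrality_strict[OF C2 less.prems(4) f2] * le(1) by force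
      qed
      have "D1 \<times> D2 \<inter> (+) b ` M \<noteq> {}"
        unfolding D[symmetric] using feasible_exposed_face[of "(z1, z2)" M b "C1 \<times> C2"] z less.prems(5) by blast
      from less.hyps[OF lt cone_face_closed_convex_cone[OF C1 f1] pointed_cone_face[OF less.prems(2) f1]
          cone_face_closed_convex_cone[OF C2 f2] pointed_cone_face[OF less.prems(4) f2] this]
      obtain F zs k where k: "k \<le> distance_to_polyhedrality D1 + distance_to_polyhedrality D2"
        and red: "reduction_sequence (C1 \<times> C2 \<inter> {(z1, z2)}\<^sup>\<bottom>) M b F zs k"
        and pps: "pps_condition (F (Suc k)) M b"
        unfolding D by blast
      from reduction_sequence_Cons[OF z red] obtain F' zs'
        where F': "reduction_sequence (C1 \<times> C2) M b F' zs' (Suc k)" "F' (Suc (Suc k)) = F (Suc k)" .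
      show ?thesis
        by (intro exI[of _ F'] exI[of _ zs'] exI[of _ "Suc k"] conjI) (use F' pps k lt in auto)
    qed
  qed
  then obtain F z k where k: "k \<le> distance_to_polyhedrality C1 + distance_to_polyhedrality C2"
    and "reduction_sequence (C1 \<times> C2) M b F z k \<and> pps_condition (F (Suc k)) M b" by blast
  then have "d_PPS (C1 \<times> C2) M b \<le> k" unfolding d_PPS_def by (intro Least_le) blast
  then show ?thesis using k by simp
qed

section \<open>Reduction to the diagonal\<close>

text \<open>The embedding stretches by the square root of \<open>2\<close>; the cruder factor
  \<open>2\<close> is harmless because constants are absorbed later.\<close>

lemma infdist_diagonal_le:
  fixes x :: "'a::euclidean_space"
  assumes "closed S" "S \<noteq> {}" "\<And>y. y \<in> S \<Longrightarrow> (y, y) \<in> T" "infdist x S \<le> \<epsilon>"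
  shows "infdist (x, x) T \<le> 2 * \<epsilon>"
proof -
  obtain y where y: "y \<in> S" "infdist x S = dist x y" using infdist_attains_inf[OF assms(1,2)] by blast
  have "dist (x, x) (y, y) \<le> dist x y + dist x y"
    using norm_Pair_le[of "x - y" "x - y"] by (simp add: dist_norm)
  then show ?thesis using assms(3)[OF y(1)] y(2) assms(4) by (intro infdist_le2[of "(y, y)"]) auto
qed

lemma infdist_le_infdist_diagonal:
  fixes x :: "'a::euclidean_space"
  assumes "T \<noteq> {}" "\<And>p. p \<in> T \<Longrightarrow> \<exists>y\<in>S. p = (y, y)"
  shows "infdist x S \<le> infdist (x, x) T"
  unfolding infdist_notempty[OF assms(1), of "(x, x)"]
proof (rule cINF_greatest[OF assms(1)])
  fix p assume "p \<in> T"
  then obtain y where y: "y \<in> S" "p = (y, y)" using assms(2) by blast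
  have "dist x y \<le> dist (x, x) (y, y)" using dist_fst_le[of "(x, x)" "(y, y)"] by simp
  then show "infdist x S \<le> dist (x, x) p" using infdist_le[OF y(1), of x] y(2) by simp
qed

lemma span_diagonal:
  fixes x :: "'a::euclidean_space"
  assumes "x \<in> span (S \<inter> T)"
  shows "(x, x) \<in> span (S \<times> T)"
proof -
  have lin: "linear (\<lambda>x::'a. (x, x))" by (intro linearI) auto
  have "(x, x) \<in> span ((\<lambda>x. (x, x)) ` (S \<inter> T))"
    unfolding linear_span_image[OF lin] using assms by blast
  moreover have "(\<lambda>x. (x, x)) ` (S \<inter> T) \<subseteq> S \<times> T" by auto
  ultimately show ?thesis using span_mono by blast
qed

text \<open>
  For \<open>\<parallel>x\<parallel> < \<epsilon>\<close> the bound is not a matter of facial reduction: either \<open>0\<close> is feasible, or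
  \<open>\<epsilon>\<close> is at least half the distance from \<open>0\<close> to the affine space.
\<close>

lemma infdist_feasible_small_norm:
  fixes A C :: "'a::euclidean_space set"
  assumes A: "closed A" "A \<inter> C \<noteq> {}" "0 \<in> C" and x: "infdist x A \<le> \<epsilon>" "norm x \<le> \<epsilon>"
  shows "infdist x (A \<inter> C) \<le> (1 + 2 * infdist 0 (A \<inter> C) / infdist 0 A) * \<epsilon>"
proof -
  have tri: "infdist x (A \<inter> C) \<le> infdist 0 (A \<inter> C) + \<epsilon>"
    using infdist_triangle[of x "A \<inter> C" 0] x(2) by simp
  have d: "infdist 0 A \<le> 2 * \<epsilon>" using infdist_triangle[of 0 A x] x by simp
  have "infdist 0 (A \<inter> C) \<le> 2 * infdist 0 (A \<inter> C) / infdist 0 A * \<epsilon>"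
  proof (cases "infdist 0 A = 0")
    \<comment> \<open>Division by zero makes the quotient \<open>0\<close>; then \<open>0\<close> is
      feasible and the left side vanishes too.\<close>
    case True
    then have "0 \<in> A" using in_closed_iff_infdist_zero[OF A(1)] A(2) by blast
    then show ?thesis using A(3) by simp
  next
    case False
    then have "infdist 0 A > 0" using infdist_nonneg[of 0 A] by linarith
    moreover have "infdist 0 (A \<inter> C) * infdist 0 A \<le> infdist 0 (A \<inter> C) * (2 * \<epsilon>)"
      using d infdist_nonneg by (intro mult_left_mono)
    ultimately show ?thesis by (simp add: field_simps)
  qed
  then show ?thesis using tri by (simp add: algebra_simps)
qed

theorem proposition40:
  fixes K1 K2 L :: "'a::euclidean_space set" and a :: 'a
    and Lh :: "('a \<times> 'a) set" and ah :: "'a \<times> 'a"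
  assumes "amenable K1" and "pointed K1"
    and "amenable K2" and "pointed K2"
    and "subspace L"
    and "K1 \<inter> K2 \<inter> (+) a ` L \<noteq> {}"
    and "subspace Lh"
    and "(+) ah ` Lh = (\<lambda>x. (x, x)) ` ((+) a ` L)"
  shows "(\<exists>\<kappa>>0. \<forall>l F z \<psi>.
      pps_chain (K1 \<times> K2) Lh ah F z l \<and>
      (\<forall>i\<in>{1..<l}. facial_residual_function (K1 \<times> K2) (F i) (z i) (\<psi> i)) \<longrightarrow>
      (\<exists>\<psi>'. (\<forall>i\<in>{1..<l}. positive_rescaling (\<psi> i) (\<psi>' i)) \<and>
         (\<forall>x\<in>span (K1 \<inter> K2). \<forall>\<epsilon>.
            infdist x (K1 \<inter> K2) \<le> \<epsilon> \<and> infdist x ((+) a ` L) \<le> \<epsilon> \<longrightarrow>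
            infdist x ((+) a ` L \<inter> K1 \<inter> K2)
              \<le> (\<kappa> * norm x + \<kappa>) * (\<epsilon> + diamonds \<psi>' (l - 1) \<epsilon> (norm x)))))
    \<and>
    (\<exists>F z. pps_chain (K1 \<times> K2) Lh ah F z (d_PPS (K1 \<times> K2) Lh ah + 1))
    \<and>
    d_PPS (K1 \<times> K2) Lh ah \<le>
      Min {distance_to_polyhedrality K1 + distance_to_polyhedrality K2,
           dim (Lh\<^sup>\<bottom> \<inter> {ah}\<^sup>\<bottom>),
           singularity_degree (K1 \<times> K2) Lh ah}"
proof -
  define A where "A = (+) a ` L"
  define K where "K = K1 \<times> K2"
  define S where "S = A \<inter> K1 \<inter> K2"
  have K1: "closed_convex_cone K1" and K2: "closed_convex_cone K2"
    using assms(1,3) by (simp_all add: amenable_def)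
  have K: "closed_convex_cone K" unfolding K_def using K1 K2 by (rule closed_convex_cone_Times)
  note K12 = closed_convex_coneD[OF closed_convex_cone_Int[OF K1 K2]]
  have Ah: "(+) ah ` Lh = (\<lambda>x. (x, x)) ` A" using assms(8) by (simp add: A_def)
  have S: "S \<noteq> {}" "S = A \<inter> (K1 \<inter> K2)" using assms(6) by (auto simp: S_def A_def)
  have clA: "closed A" unfolding A_def using assms(5) by (simp add: closed_subspace closed_translation)
  have feas: "K \<inter> (+) ah ` Lh \<noteq> {}" using S(1) unfolding Ah K_def S_def by blast
  have lift: "(x, x) \<in> span K" "infdist (x, x) K \<le> 2 * \<epsilon>" "infdist (x, x) ((+) ah ` Lh) \<le> 2 * \<epsilon>"
    "norm (x, x) \<le> 2 * norm x" "infdist x S \<le> infdist (x, x) (K \<inter> (+) ah ` Lh)"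
    if x: "x \<in> span (K1 \<inter> K2)" "infdist x (K1 \<inter> K2) \<le> \<epsilon>" "infdist x A \<le> \<epsilon>" for x \<epsilon>
  proof -
    show "(x, x) \<in> span K" unfolding K_def using x(1) by (rule span_diagonal)
    show "infdist (x, x) K \<le> 2 * \<epsilon>"
      using K12(1,5) _ x(2) by (rule infdist_diagonal_le) (simp add: K_def)
    show "infdist (x, x) ((+) ah ` Lh) \<le> 2 * \<epsilon>"
      using clA _ _ x(3) by (rule infdist_diagonal_le) (use S Ah in auto)
    show "norm (x, x) \<le> 2 * norm x" using norm_Pair_le[of x x] by simp
    show "infdist x S \<le> infdist (x, x) (K \<inter> (+) ah ` Lh)"
      using feas by (rule infdist_le_infdist_diagonal) (auto simp: Ah K_def S_def)
  qed
  define \<kappa>0 where "\<kappa>0 = 1 + 2 * infdist 0 S / infdist 0 A"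
  have \<kappa>0: "1 \<le> \<kappa>0" by (simp add: \<kappa>0_def infdist_nonneg)
  \<comment> \<open>With the PPS condition as a premise of the bound, \<open>\<kappa>1\<close> is
    fixed before any chain; if the condition fails, no chain of length \<open>1\<close> exists and
    any value will do.\<close>
  obtain \<kappa>1 where \<kappa>1: "\<kappa>1 > 0" "\<And>x \<epsilon>. pps_condition K Lh ah \<Longrightarrow> infdist x K \<le> \<epsilon> \<Longrightarrow>
      infdist x ((+) ah ` Lh) \<le> \<epsilon> \<Longrightarrow> infdist x (K \<inter> (+) ah ` Lh) \<le> \<kappa>1 * (norm x + 1) * \<epsilon>"
  proof (cases "pps_condition K Lh ah")
    case True
    from pps_error_bound[OF this assms(7)] show ?thesis using that by blast
  next
    case False
    then show ?thesis using that[of 1] by auto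
  qed
  \<comment> \<open>In the factor \<open>4\<close>, one \<open>2\<close> comes from the norm of
    \<open>(x, x)\<close> and one from its distances.\<close>
  define \<kappa> where "\<kappa> = \<kappa>0 + 4 * \<kappa>1"
  have \<kappa>: "1 \<le> \<kappa>" "\<kappa>0 \<le> \<kappa>" "4 * \<kappa>1 \<le> \<kappa>" using \<kappa>0 \<kappa>1(1) by (auto simp: \<kappa>_def)
  have part1: "\<exists>\<psi>'. (\<forall>i\<in>{1..<l}. positive_rescaling (\<psi> i) (\<psi>' i)) \<and>
         (\<forall>x\<in>span (K1 \<inter> K2). \<forall>\<epsilon>. infdist x (K1 \<inter> K2) \<le> \<epsilon> \<and> infdist x A \<le> \<epsilon> \<longrightarrow>
            infdist x S \<le> (\<kappa> * norm x + \<kappa>) * (\<epsilon> + diamonds \<psi>' (l - 1) \<epsilon> (norm x)))"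
    if chain: "pps_chain K Lh ah F z l"
      and frf: "\<forall>i\<in>{1..<l}. facial_residual_function K (F i) (z i) (\<psi> i)" for l F z \<psi>
  proof (cases "l = 1")
    case True
    then have "pps_condition K Lh ah"
      using chain by (auto simp: pps_chain_def reduction_sequence_def)
    note bound = \<kappa>1(2)[OF this]
    \<comment> \<open>One \<open>\<epsilon>\<close> stands for the empty composition.\<close>
    have "infdist x S \<le> (\<kappa> * norm x + \<kappa>) * (\<epsilon> + \<epsilon>)"
      if x: "x \<in> span (K1 \<inter> K2)" "infdist x (K1 \<inter> K2) \<le> \<epsilon>" "infdist x A \<le> \<epsilon>" for x \<epsilon>
    proof -
      note l = lift[OF x]
      have e0: "0 \<le> \<epsilon>" using x(3) infdist_nonneg[of x A] by linarith
      have "infdist x S \<le> \<kappa>1 * (norm (x, x) + 1) * (2 * \<epsilon>)"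
        using l(5) bound[OF l(2,3)] by linarith
      also have "\<dots> \<le> \<kappa>1 * (2 * (norm x + 1)) * (2 * \<epsilon>)"
        using l(4) \<kappa>1(1) e0 by (intro mult_right_mono mult_left_mono) auto
      also have "\<dots> = (4 * \<kappa>1) * ((norm x + 1) * \<epsilon>)" by simp
      also have "\<dots> \<le> \<kappa> * ((norm x + 1) * \<epsilon>)"
        using \<kappa>(3) e0 by (intro mult_right_mono mult_nonneg_nonneg) auto
      also have "\<dots> = (\<kappa> * norm x + \<kappa>) * \<epsilon>" by (simp add: algebra_simps)
      also have "\<dots> \<le> (\<kappa> * norm x + \<kappa>) * (\<epsilon> + \<epsilon>)"
        using e0 \<kappa>(1) by (intro mult_left_mono) auto
      finally show ?thesis .
    qed
    then show ?thesis using True by (intro exI[of _ \<psi>]) auto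
  next
    case False
    then obtain n where n: "l = Suc n" "1 \<le> n" using chain by (cases l) (auto simp: pps_chain_def)
    have iv: "{1..<l} = {1..n}" using n(1) by auto
    obtain \<psi>' where resc: "\<forall>i\<in>{1..n}. positive_rescaling (\<psi> i) (\<psi>' i)"
      and nonneg: "\<And>\<epsilon> t. 0 \<le> \<epsilon> \<Longrightarrow> 0 \<le> t \<Longrightarrow> 0 \<le> diamonds \<psi>' n \<epsilon> t"
      and bound: "\<And>x \<epsilon> t. x \<in> span K \<Longrightarrow> infdist x K \<le> 2 * \<epsilon> \<Longrightarrow> infdist x ((+) ah ` Lh) \<le> 2 * \<epsilon> \<Longrightarrow>
         norm x \<le> 2 * t \<Longrightarrow> \<epsilon> \<le> t \<Longrightarrow> infdist x (K \<inter> (+) ah ` Lh) \<le> (1 + t) * diamonds \<psi>' n \<epsilon> t"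
      using pps_chain_error_bound[OF K assms(7) chain[unfolded n(1)] n(2) frf[unfolded iv]]
      by (elim exE conjE) metis
    have "infdist x S \<le> (\<kappa> * norm x + \<kappa>) * (\<epsilon> + diamonds \<psi>' n \<epsilon> (norm x))"
      if x: "x \<in> span (K1 \<inter> K2)" "infdist x (K1 \<inter> K2) \<le> \<epsilon>" "infdist x A \<le> \<epsilon>" for x \<epsilon>
    proof -
      note l = lift[OF x]
      have e0: "0 \<le> \<epsilon>" using x(3) infdist_nonneg[of x A] by linarith
      define g where "g = diamonds \<psi>' n \<epsilon> (norm x)"
      have g: "0 \<le> g" unfolding g_def using nonneg e0 by simp
      show ?thesis unfolding g_def[symmetric]
      \<comment> \<open>Only for \<open>\<epsilon> \<le> norm x\<close> does the chain bound apply;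
        otherwise \<open>\<kappa>0\<close> is enough and the residual functions enter by their sign
        alone.\<close>
      proof (cases "\<epsilon> \<le> norm x")
        case True
        have "infdist x S \<le> (1 + norm x) * g" unfolding g_def using l(5) bound[OF l(1-4) True] by linarith
        also have "\<dots> \<le> (\<kappa> * (1 + norm x)) * (\<epsilon> + g)"
          using \<kappa>(1) e0 g mult_right_mono[OF \<kappa>(1), of "1 + norm x"] by (intro mult_mono) auto
        finally show "infdist x S \<le> (\<kappa> * norm x + \<kappa>) * (\<epsilon> + g)" by (simp add: algebra_simps)
      next
        case False
        then have "infdist x S \<le> \<kappa>0 * \<epsilon>" unfolding \<kappa>0_def S(2)
          using clA S K12(4) x(3) by (intro infdist_feasible_small_norm) auto
        also have "\<dots> \<le> (\<kappa> * norm x + \<kappa>) * (\<epsilon> + g)"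
          using \<kappa> \<kappa>0 e0 g by (intro mult_mono) (auto intro: add_increasing)
        finally show "infdist x S \<le> (\<kappa> * norm x + \<kappa>) * (\<epsilon> + g)" .
      qed
    qed
    then show ?thesis using resc n(1) iv by (intro exI[of _ \<psi>']) auto
  qed
  let ?d = "d_PPS K Lh ah"
  obtain F z where red: "reduction_sequence K Lh ah F z ?d" and pps: "pps_condition (F (Suc ?d)) Lh ah"
    using d_PPS_le_singularity_degree(1)[OF K assms(7) feas] by blast
  have strict: "F (Suc i) \<subset> F i" if "1 \<le> i" "i \<le> ?d" for i
    using d_PPS_sequence_strict[OF red pps that] .
  have "pps_chain K Lh ah F z (?d + 1)"
    unfolding pps_chain_def
    using red pps strict reduction_sequence_face[OF closed_convex_coneD(2)[OF K] red] by auto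
  moreover have "?d \<le> dim (Lh\<^sup>\<bottom> \<inter> {ah}\<^sup>\<bottom>)"
    using red strict by (intro strict_reduction_length_le_dim) auto
  moreover have "?d \<le> distance_to_polyhedrality K1 + distance_to_polyhedrality K2"
    using feas unfolding K_def
    by (intro d_PPS_le_distance_to_polyhedrality K1 K2 assms(2,4,7))
  moreover have "?d \<le> singularity_degree K Lh ah"
    using d_PPS_le_singularity_degree(2)[OF K assms(7) feas] .
  moreover have "\<kappa> > 0" using \<kappa>(1) by simp
  ultimately show ?thesis
    using part1 unfolding K_def A_def S_def by (intro conjI exI[of _ \<kappa>]) auto
qed

end
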